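(* Let $S=\{0,1\}\times[0,+\infty)$, where $[0,+\infty)\subseteq R$, ordered by the relation $\sqsubseteq_S$ given by the clauses (for $x\in\{0,1\}$ and $a,b\in[0,+\infty)$): 1. $(x,a)\sqsubseteq_S(x,b)$ precisely if $a\le b$; 2. $(0,a)\sqsubseteq_S(1,b)$ precisely if $a+2\le b$; 3. $(1,a)\sqsubseteq_S(0,b)$ precisely if $a+1\le b$. Then the poset $(S,\sqsubseteq_S)$ has a definable covariant regular representation, and the resulting definable Heyting algebra $(H,\sqsubseteq)$ (isomorphic to the lattice of definable downward-closed subsets of $S$ under inclusion) contains the free Heyting algebra on one generator $F_1$ as a Heyting subalgebra.
   Context: Fix an o-minimal structure $R$ expanding a real-closed field. "Definable" means definable in $R$ with parameters. A definable covariant regular representation of a definable poset $(P,\sqsubseteq_P)$ is a pair $(L,E)$ consisting of a definable set $L$ (of codes) and a definable relation $E\subseteq P\times L$ such that (1) for each $x\in L$ the set $E_x=\{y\in P: yEx\}$ is a downward-closed subset of $P$; (2) for every definable downward-closed $S\subseteq P$ there is a unique $x\in L$ with $E_x=S$. The code set $L$ is ordered by $c\sqsubseteq d$ iff $E_c\subseteq E_d$; with this order $L$ is a definable Heyting algebra isomorphic to the lattice of definable downward-closed subsets of $P$, with implication $B\Rightarrow C=\{p\in P : \{y: y\sqsubseteq_P p\}\cap B\subseteq C\}$. *)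

theory Defs
  imports "HOL-Algebra.Lattice"
begin

section \<open>Expansions of real-closed fields and o-minimality\<close>

text \<open>Polynomials are written as coefficient sequences, as in the class \<open>alg_closed_field\<close>.\<close>

class real_closed_field = linordered_field +
  assumes nonneg_is_square: "0 \<le> a \<Longrightarrow> \<exists>x. x * x = a"
    and odd_degree_root: "odd n \<Longrightarrow> f n \<noteq> 0 \<Longrightarrow> \<exists>x. (\<Sum>k\<le>n. f k * x ^ k) = 0"

text \<open>
  The additional primitives of a structure whose reduct is the ordered field \<open>'a\<close>. The symbols
  in \<open>'f\<close> and \<open>'r\<close> carry no fixed arity: a symbol applied to \<open>k\<close> arguments acts as a \<open>k\<close>-ary
  symbol, separately for each \<open>k\<close>. An arity-respecting signature is the case in which the
  interpretation is constant on lists of all other lengths.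
\<close>

record ('a, 'f, 'r) expansion =
  fun_int :: "'f \<Rightarrow> 'a list \<Rightarrow> 'a"
  rel_int :: "'r \<Rightarrow> 'a list \<Rightarrow> bool"

datatype ('a, 'f) tm =
  Var nat | Param 'a | Plus "('a, 'f) tm" "('a, 'f) tm" | Times "('a, 'f) tm" "('a, 'f) tm"
  | App 'f "('a, 'f) tm list"

text \<open>\<open>Ex\<close> binds the de Bruijn index 0.\<close>

datatype ('a, 'f, 'r) fm =
  Eq "('a, 'f) tm" "('a, 'f) tm" | Less "('a, 'f) tm" "('a, 'f) tm" | Rel 'r "('a, 'f) tm list"
  | Neg "('a, 'f, 'r) fm" | Conj "('a, 'f, 'r) fm" "('a, 'f, 'r) fm" | Ex "('a, 'f, 'r) fm"

primrec tm_val :: "('a::linordered_field, 'f, 'r) expansion \<Rightarrow> (nat \<Rightarrow> 'a) \<Rightarrow> ('a, 'f) tm \<Rightarrow> 'a" where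
  "tm_val R e (Var i) = e i"
| "tm_val R e (Param a) = a"
| "tm_val R e (Plus s t) = tm_val R e s + tm_val R e t"
| "tm_val R e (Times s t) = tm_val R e s * tm_val R e t"
| "tm_val R e (App g ts) = fun_int R g (map (tm_val R e) ts)"

primrec sat :: "('a::linordered_field, 'f, 'r) expansion \<Rightarrow> (nat \<Rightarrow> 'a) \<Rightarrow> ('a, 'f, 'r) fm \<Rightarrow> bool" where
  "sat R e (Eq s t) \<longleftrightarrow> tm_val R e s = tm_val R e t"
| "sat R e (Less s t) \<longleftrightarrow> tm_val R e s < tm_val R e t"
| "sat R e (Rel r ts) \<longleftrightarrow> rel_int R r (map (tm_val R e) ts)"
| "sat R e (Neg p) \<longleftrightarrow> \<not> sat R e p"
| "sat R e (Conj p q) \<longleftrightarrow> sat R e p \<and> sat R e q"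
| "sat R e (Ex p) \<longleftrightarrow> (\<exists>x. sat R (case_nat x e) p)"

text \<open>
  Points of \<open>R^n\<close> are lists of length \<open>n\<close>. Variables beyond the length of the list denote 0,
  which is harmless since parameters are allowed.
\<close>

definition assignment :: "'a::zero list \<Rightarrow> nat \<Rightarrow> 'a" where
  "assignment xs i = (if i < length xs then xs ! i else 0)"

definition definable :: "('a::linordered_field, 'f, 'r) expansion \<Rightarrow> nat \<Rightarrow> 'a list set \<Rightarrow> bool" where
  "definable R n X \<longleftrightarrow> (\<exists>p. X = {xs. length xs = n \<and> sat R (assignment xs) p})"

definition point_or_open_interval :: "'a::linorder set \<Rightarrow> bool" where
  "point_or_open_interval I \<longleftrightarrow>
     (\<exists>a. I = {a}) \<or> (\<exists>a b. I = {a<..<b}) \<or> (\<exists>b. I = {..<b}) \<or> (\<exists>a. I = {a<..}) \<or> I = UNIV"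

definition o_minimal :: "('a::linordered_field, 'f, 'r) expansion \<Rightarrow> bool" where
  "o_minimal R \<longleftrightarrow>
     (\<forall>X. definable R 1 ((\<lambda>x. [x]) ` X) \<longrightarrow>
       (\<exists>F. finite F \<and> (\<forall>I\<in>F. point_or_open_interval I) \<and> X = \<Union>F))"


section \<open>Definable posets and covariant regular representations\<close>

definition definable_poset ::
    "('a::linordered_field, 'f, 'r) expansion \<Rightarrow> nat \<Rightarrow> 'a list gorder \<Rightarrow> bool" where
  "definable_poset R n P \<longleftrightarrow> partial_order P \<and> definable R n (carrier P) \<and>
     definable R (n + n) {x @ y | x y. x \<in> carrier P \<and> y \<in> carrier P \<and> x \<sqsubseteq>\<^bsub>P\<^esub> y}"

definition down_closed :: "'a gorder \<Rightarrow> 'a set \<Rightarrow> bool" where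
  "down_closed P X \<longleftrightarrow> X \<subseteq> carrier P \<and> (\<forall>x\<in>X. \<forall>y\<in>carrier P. y \<sqsubseteq>\<^bsub>P\<^esub> x \<longrightarrow> y \<in> X)"

definition definable_downsets ::
    "('a::linordered_field, 'f, 'r) expansion \<Rightarrow> nat \<Rightarrow> 'a list gorder \<Rightarrow> 'a list set gorder" where
  "definable_downsets R n P =
     \<lparr>carrier = {X. definable R n X \<and> down_closed P X}, eq = (=), le = (\<subseteq>)\<rparr>"

definition fiber :: "('a \<times> 'b) set \<Rightarrow> 'b \<Rightarrow> 'a set" where
  "fiber E x = {y. (y, x) \<in> E}"

definition covariant_regular_rep ::
    "('a::linordered_field, 'f, 'r) expansion \<Rightarrow> nat \<Rightarrow> 'a list gorder \<Rightarrow>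
     nat \<Rightarrow> 'a list set \<Rightarrow> ('a list \<times> 'a list) set \<Rightarrow> bool" where
  "covariant_regular_rep R n P m L E \<longleftrightarrow>
     definable_poset R n P \<and> definable R m L \<and>
     E \<subseteq> carrier P \<times> L \<and> definable R (n + m) {y @ x | y x. (y, x) \<in> E} \<and>
     (\<forall>x\<in>L. down_closed P (fiber E x)) \<and>
     (\<forall>X. definable R n X \<and> down_closed P X \<longrightarrow> (\<exists>!x. x \<in> L \<and> fiber E x = X))"

definition code_order :: "'b set \<Rightarrow> ('a \<times> 'b) set \<Rightarrow> 'b gorder" where
  "code_order L E = \<lparr>carrier = L, eq = (=), le = (\<lambda>c d. fiber E c \<subseteq> fiber E d)\<rparr>"


section \<open>Heyting algebras\<close>

definition relpc_set :: "'a gorder \<Rightarrow> 'a \<Rightarrow> 'a \<Rightarrow> 'a set" where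
  "relpc_set A x y = {z \<in> carrier A. z \<sqinter>\<^bsub>A\<^esub> x \<sqsubseteq>\<^bsub>A\<^esub> y}"

locale heyting_algebra = bounded_lattice A for A :: "'a gorder" (structure) +
  assumes himp_exists:
    "\<lbrakk>x \<in> carrier A; y \<in> carrier A\<rbrakk> \<Longrightarrow> \<exists>z. greatest A z (relpc_set A x y)"

definition himp :: "'a gorder \<Rightarrow> 'a \<Rightarrow> 'a \<Rightarrow> 'a" where
  "himp A x y = (SOME z. greatest A z (relpc_set A x y))"

definition definable_heyting_algebra ::
    "('a::linordered_field, 'f, 'r) expansion \<Rightarrow> nat \<Rightarrow> 'a list gorder \<Rightarrow> bool" where
  "definable_heyting_algebra R n A \<longleftrightarrow> definable_poset R n A \<and> heyting_algebra A"

definition heyting_hom :: "'a gorder \<Rightarrow> 'b gorder \<Rightarrow> ('a \<Rightarrow> 'b) set" where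
  "heyting_hom A B = {h. (\<forall>x\<in>carrier A. h x \<in> carrier B) \<and>
     h \<bottom>\<^bsub>A\<^esub> = \<bottom>\<^bsub>B\<^esub> \<and> h \<top>\<^bsub>A\<^esub> = \<top>\<^bsub>B\<^esub> \<and>
     (\<forall>x\<in>carrier A. \<forall>y\<in>carrier A.
        h (x \<sqinter>\<^bsub>A\<^esub> y) = h x \<sqinter>\<^bsub>B\<^esub> h y \<and> h (x \<squnion>\<^bsub>A\<^esub> y) = h x \<squnion>\<^bsub>B\<^esub> h y \<and>
        h (himp A x y) = himp B (h x) (h y))}"

definition heyting_subalgebra :: "'a set \<Rightarrow> 'a gorder \<Rightarrow> bool" where
  "heyting_subalgebra K A \<longleftrightarrow> K \<subseteq> carrier A \<and> \<bottom>\<^bsub>A\<^esub> \<in> K \<and> \<top>\<^bsub>A\<^esub> \<in> K \<and>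
     (\<forall>x\<in>K. \<forall>y\<in>K. x \<sqinter>\<^bsub>A\<^esub> y \<in> K \<and> x \<squnion>\<^bsub>A\<^esub> y \<in> K \<and> himp A x y \<in> K)"


section \<open>Free Heyting algebras\<close>

text \<open>
  The free Heyting algebra on \<open>'v\<close> is the quotient of the term algebra by the least preorder
  satisfying the laws of a Heyting algebra. It is a Heyting algebra and has the universal
  property with respect to Heyting algebras over arbitrary types: see
  \<open>free_heyting_is_heyting_algebra\<close> and \<open>free_heyting_universal\<close> below.
\<close>

datatype 'v hterm =
  HVar 'v | HBot | HTop | HMeet "'v hterm" "'v hterm" | HJoin "'v hterm" "'v hterm"
  | HImp "'v hterm" "'v hterm"

inductive hle :: "'v hterm \<Rightarrow> 'v hterm \<Rightarrow> bool" where
  hle_refl: "hle s s"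
| hle_trans: "hle s t \<Longrightarrow> hle t u \<Longrightarrow> hle s u"
| hle_bot: "hle HBot s"
| hle_top: "hle s HTop"
| hle_meet1: "hle (HMeet s t) s"
| hle_meet2: "hle (HMeet s t) t"
| hle_meetI: "hle u s \<Longrightarrow> hle u t \<Longrightarrow> hle u (HMeet s t)"
| hle_join1: "hle s (HJoin s t)"
| hle_join2: "hle t (HJoin s t)"
| hle_joinI: "hle s u \<Longrightarrow> hle t u \<Longrightarrow> hle (HJoin s t) u"
| hle_impI: "hle (HMeet u s) t \<Longrightarrow> hle u (HImp s t)"
| hle_impE: "hle u (HImp s t) \<Longrightarrow> hle (HMeet u s) t"

definition hequiv :: "('v hterm \<times> 'v hterm) set" where
  "hequiv = {(s, t). hle s t \<and> hle t s}"

definition free_heyting :: "'v hterm set gorder" where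
  "free_heyting = \<lparr>carrier = UNIV // hequiv, eq = (=), le = (\<lambda>X Y. \<exists>s\<in>X. \<exists>t\<in>Y. hle s t)\<rparr>"

definition F1 :: "unit hterm set gorder" where
  "F1 = free_heyting"

definition hclass :: "'v hterm \<Rightarrow> 'v hterm set" where
  "hclass t = hequiv `` {t}"

lemma equiv_hequiv: "equiv UNIV hequiv"
proof (rule equivI)
  show "trans hequiv"
    by (rule transI) (use hle_trans in \<open>simp add: hequiv_def, blast\<close>)
qed (simp_all add: refl_on_def sym_def hequiv_def hle_refl)

lemma carrier_free_heyting: "carrier free_heyting = range hclass"
  by (auto simp: free_heyting_def hclass_def quotient_def)

lemma hclass_in_carrier [simp]: "hclass t \<in> carrier free_heyting"
  by (simp add: carrier_free_heyting)

lemma hclass_eq_iff: "hclass s = hclass t \<longleftrightarrow> hle s t \<and> hle t s"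
proof -
  have "hclass s = hclass t \<longleftrightarrow> (s, t) \<in> hequiv"
    unfolding hclass_def by (rule eq_equiv_class_iff[OF equiv_hequiv UNIV_I UNIV_I])
  then show ?thesis
    by (simp add: hequiv_def)
qed

lemma le_hclass_iff [simp]: "hclass s \<sqsubseteq>\<^bsub>free_heyting\<^esub> hclass t \<longleftrightarrow> hle s t"
proof
  assume "hclass s \<sqsubseteq>\<^bsub>free_heyting\<^esub> hclass t"
  then obtain s' t' where "hle s s'" "hle s' t'" "hle t' t"
    by (auto simp: free_heyting_def hclass_def hequiv_def)
  then show "hle s t"
    using hle_trans by metis
next
  assume "hle s t"
  moreover have "s \<in> hclass s" "t \<in> hclass t"
    by (simp_all add: hclass_def hequiv_def hle_refl)
  ultimately show "hclass s \<sqsubseteq>\<^bsub>free_heyting\<^esub> hclass t"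
    by (auto simp: free_heyting_def)
qed

lemma partial_order_free_heyting: "partial_order (free_heyting :: 'v hterm set gorder)"
proof -
  have eq: "(.=\<^bsub>free_heyting\<^esub>) = ((=) :: 'v hterm set \<Rightarrow> _)"
    by (simp add: free_heyting_def)
  show ?thesis
  proof unfold_locales
    fix x y z :: "'v hterm set"
    assume *: "x \<in> carrier free_heyting" "y \<in> carrier free_heyting" "z \<in> carrier free_heyting"
      "x \<sqsubseteq>\<^bsub>free_heyting\<^esub> y" "y \<sqsubseteq>\<^bsub>free_heyting\<^esub> z"
    then obtain r s t where "x = hclass r" "y = hclass s" "z = hclass t"
      by (auto simp: carrier_free_heyting)
    then show "x \<sqsubseteq>\<^bsub>free_heyting\<^esub> z"
      using * hle_trans[of r s t] by simp
  next
    fix x y :: "'v hterm set"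
    assume *: "x \<in> carrier free_heyting" "y \<in> carrier free_heyting"
      "x \<sqsubseteq>\<^bsub>free_heyting\<^esub> y" "y \<sqsubseteq>\<^bsub>free_heyting\<^esub> x"
    then obtain s t where "x = hclass s" "y = hclass t"
      by (auto simp: carrier_free_heyting)
    then show "x .=\<^bsub>free_heyting\<^esub> y"
      using * by (simp add: eq hclass_eq_iff)
  qed (auto simp: eq carrier_free_heyting hle_refl)
qed

lemma greatest_hclass_meet:
  "greatest free_heyting (hclass (HMeet s t)) (Lower free_heyting {hclass s, hclass t})"
proof -
  have "Lower free_heyting {hclass s, hclass t} =
      {x \<in> carrier free_heyting. x \<sqsubseteq>\<^bsub>free_heyting\<^esub> hclass s \<and> x \<sqsubseteq>\<^bsub>free_heyting\<^esub> hclass t}"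
    unfolding Lower_def using hclass_in_carrier by blast
  then show ?thesis
    by (simp add: greatest_def carrier_free_heyting hle_meet1 hle_meet2)
      (use hle_meetI in auto)
qed

lemma least_hclass_join:
  "least free_heyting (hclass (HJoin s t)) (Upper free_heyting {hclass s, hclass t})"
proof -
  have "Upper free_heyting {hclass s, hclass t} =
      {x \<in> carrier free_heyting. hclass s \<sqsubseteq>\<^bsub>free_heyting\<^esub> x \<and> hclass t \<sqsubseteq>\<^bsub>free_heyting\<^esub> x}"
    unfolding Upper_def using hclass_in_carrier by blast
  then show ?thesis
    by (simp add: least_def carrier_free_heyting hle_join1 hle_join2)
      (use hle_joinI in auto)
qed

lemma least_hclass_bot: "least free_heyting (hclass HBot) (carrier free_heyting)"
  by (auto simp: least_def carrier_free_heyting intro: hle_bot)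

lemma greatest_hclass_top: "greatest free_heyting (hclass HTop) (carrier free_heyting)"
  by (auto simp: greatest_def carrier_free_heyting intro: hle_top)

lemma bounded_lattice_free_heyting: "bounded_lattice (free_heyting :: 'v hterm set gorder)"
proof -
  interpret partial_order "free_heyting :: 'v hterm set gorder"
    by (rule partial_order_free_heyting)
  show ?thesis
  proof unfold_locales
    fix x y :: "'v hterm set"
    assume "x \<in> carrier free_heyting" "y \<in> carrier free_heyting"
    then show "\<exists>s. least free_heyting s (Upper free_heyting {x, y})"
      and "\<exists>s. greatest free_heyting s (Lower free_heyting {x, y})"
      using greatest_hclass_meet least_hclass_join by (auto simp: carrier_free_heyting) blast+
  qed (use least_hclass_bot greatest_hclass_top in blast)+
qed

lemma hclass_meet: "hclass s \<sqinter>\<^bsub>free_heyting\<^esub> hclass t = hclass (HMeet s t)"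
proof -
  interpret bounded_lattice "free_heyting :: 'a hterm set gorder"
    by (rule bounded_lattice_free_heyting)
  show ?thesis
    unfolding meet_def
    by (rule greatest_unique[OF inf_of_two_greatest greatest_hclass_meet]) simp_all
qed

lemma hclass_join: "hclass s \<squnion>\<^bsub>free_heyting\<^esub> hclass t = hclass (HJoin s t)"
proof -
  interpret bounded_lattice "free_heyting :: 'a hterm set gorder"
    by (rule bounded_lattice_free_heyting)
  show ?thesis
    unfolding join_def
    by (rule least_unique[OF sup_of_two_least least_hclass_join]) simp_all
qed

lemma hclass_bot: "\<bottom>\<^bsub>free_heyting\<^esub> = hclass HBot"
proof -
  interpret bounded_lattice "free_heyting :: 'a hterm set gorder"
    by (rule bounded_lattice_free_heyting)
  show ?thesis
    using least_hclass_bot bottom_least by (rule least_unique[symmetric])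
qed

lemma hclass_top: "\<top>\<^bsub>free_heyting\<^esub> = hclass HTop"
proof -
  interpret bounded_lattice "free_heyting :: 'a hterm set gorder"
    by (rule bounded_lattice_free_heyting)
  show ?thesis
    using greatest_hclass_top top_greatest by (rule greatest_unique[symmetric])
qed

lemma greatest_hclass_imp:
  "greatest free_heyting (hclass (HImp s t)) (relpc_set free_heyting (hclass s) (hclass t))"
  using hle_impE[OF hle_refl, of s t]
  by (auto simp: greatest_def relpc_set_def carrier_free_heyting hclass_meet hle_impI)

theorem free_heyting_is_heyting_algebra:
  "heyting_algebra (free_heyting :: 'v hterm set gorder)"
proof -
  interpret bounded_lattice "free_heyting :: 'v hterm set gorder"
    by (rule bounded_lattice_free_heyting)
  show ?thesis
  proof unfold_locales
    fix x y :: "'v hterm set"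
    assume "x \<in> carrier free_heyting" "y \<in> carrier free_heyting"
    then obtain s t where "x = hclass s" "y = hclass t"
      by (auto simp: carrier_free_heyting)
    then show "\<exists>z. greatest free_heyting z (relpc_set free_heyting x y)"
      using greatest_hclass_imp by blast
  qed
qed

context heyting_algebra
begin

lemma himp_greatest:
  "\<lbrakk>x \<in> carrier A; y \<in> carrier A\<rbrakk> \<Longrightarrow> greatest A (himp A x y) (relpc_set A x y)"
  unfolding himp_def by (rule someI_ex[OF himp_exists])

lemma himp_closed: "\<lbrakk>x \<in> carrier A; y \<in> carrier A\<rbrakk> \<Longrightarrow> himp A x y \<in> carrier A"
  by (rule greatest_closed[OF himp_greatest])

lemma meet_mono_left:
  assumes "x \<sqsubseteq> x'" "x \<in> carrier A" "x' \<in> carrier A" "y \<in> carrier A"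
  shows "x \<sqinter> y \<sqsubseteq> x' \<sqinter> y"
proof (rule meet_le)
  show "x \<sqinter> y \<sqsubseteq> x'"
    using meet_left[of x y] assms by (rule_tac le_trans) simp_all
qed (use assms in \<open>simp_all add: meet_right\<close>)

lemma himp_residuation:
  assumes "x \<in> carrier A" "y \<in> carrier A" "z \<in> carrier A"
  shows "z \<sqsubseteq> himp A x y \<longleftrightarrow> z \<sqinter> x \<sqsubseteq> y"
proof
  have *: "himp A x y \<sqinter> x \<sqsubseteq> y"
    using himp_greatest[OF assms(1,2)] by (auto simp: greatest_def relpc_set_def)
  show "z \<sqinter> x \<sqsubseteq> y" if "z \<sqsubseteq> himp A x y"
    by (rule le_trans[OF meet_mono_left[OF that] *]) (simp_all add: assms himp_closed)
  show "z \<sqsubseteq> himp A x y" if "z \<sqinter> x \<sqsubseteq> y"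
    using himp_greatest[OF assms(1,2)] assms that by (auto simp: greatest_def relpc_set_def)
qed

end

primrec hval :: "'a gorder \<Rightarrow> ('v \<Rightarrow> 'a) \<Rightarrow> 'v hterm \<Rightarrow> 'a" where
  "hval A f (HVar v) = f v"
| "hval A f HBot = \<bottom>\<^bsub>A\<^esub>"
| "hval A f HTop = \<top>\<^bsub>A\<^esub>"
| "hval A f (HMeet s t) = hval A f s \<sqinter>\<^bsub>A\<^esub> hval A f t"
| "hval A f (HJoin s t) = hval A f s \<squnion>\<^bsub>A\<^esub> hval A f t"
| "hval A f (HImp s t) = himp A (hval A f s) (hval A f t)"

lemma hclass_himp: "himp free_heyting (hclass s) (hclass t) = hclass (HImp s t)"
proof -
  interpret heyting_algebra "free_heyting :: 'a hterm set gorder"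
    by (rule free_heyting_is_heyting_algebra)
  show ?thesis
    by (rule greatest_unique[OF himp_greatest greatest_hclass_imp]) simp_all
qed

theorem free_heyting_universal:
  fixes f :: "'v \<Rightarrow> 'a"
  assumes A: "heyting_algebra A" and f: "\<And>v. f v \<in> carrier A"
  shows "\<exists>h\<in>heyting_hom free_heyting A. (\<forall>v. h (hclass (HVar v)) = f v) \<and>
    (\<forall>g\<in>heyting_hom free_heyting A. (\<forall>v. g (hclass (HVar v)) = f v) \<longrightarrow>
      (\<forall>X\<in>carrier free_heyting. g X = h X))"
proof -
  interpret heyting_algebra A by (rule A)
  have cl: "hval A f t \<in> carrier A" for t
    by (induction t) (auto simp: f himp_closed)
  have mono: "le A (hval A f s) (hval A f t)" if "hle s t" for s t
    using that
  proof induction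
    case (hle_trans s t u)
    show ?case by (rule le_trans[OF hle_trans.IH]) (simp_all add: cl)
  next
    case (hle_meetI u s t)
    then show ?case by (simp add: meet_le cl)
  next
    case (hle_joinI s u t)
    then show ?case by (simp add: join_le cl)
  qed (simp_all add: cl meet_left meet_right join_left join_right himp_residuation)
  define h where "h X = hval A f (SOME t. hclass t = X)" for X
  have h: "h (hclass t) = hval A f t" for t
  proof -
    have "hclass (SOME s. hclass s = hclass t) = hclass t"
      by (rule someI[of "\<lambda>s. hclass s = hclass t" t]) simp
    then show ?thesis
      unfolding h_def hclass_eq_iff by (metis le_antisym mono cl)
  qed
  have "h \<in> heyting_hom free_heyting A"
    by (auto simp: heyting_hom_def carrier_free_heyting hclass_bot hclass_top hclass_meet
        hclass_join hclass_himp h cl)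
  moreover have "g (hclass t) = h (hclass t)"
    if g: "g \<in> heyting_hom free_heyting A" "\<forall>v. g (hclass (HVar v)) = f v" for g t
  proof (induction t)
    case HBot
    then show ?case using g by (simp add: heyting_hom_def h hclass_bot)
  next
    case HTop
    then show ?case using g by (simp add: heyting_hom_def h hclass_top)
  next
    case (HMeet s t)
    have "g (hclass s \<sqinter>\<^bsub>free_heyting\<^esub> hclass t) = g (hclass s) \<sqinter>\<^bsub>A\<^esub> g (hclass t)"
      using g by (simp add: heyting_hom_def)
    then show ?case using HMeet by (simp add: hclass_meet h)
  next
    case (HJoin s t)
    have "g (hclass s \<squnion>\<^bsub>free_heyting\<^esub> hclass t) = g (hclass s) \<squnion>\<^bsub>A\<^esub> g (hclass t)"
      using g by (simp add: heyting_hom_def)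
    then show ?case using HJoin by (simp add: hclass_join h)
  next
    case (HImp s t)
    have "g (himp free_heyting (hclass s) (hclass t)) = himp A (g (hclass s)) (g (hclass t))"
      using g by (simp add: heyting_hom_def)
    then show ?case using HImp by (simp add: hclass_himp h)
  qed (use g in \<open>simp add: h\<close>)
  ultimately show ?thesis
    by (intro bexI[of _ h]) (auto simp: h carrier_free_heyting)
qed


section \<open>The poset \<open>S\<close>\<close>

definition S_le :: "'a::linordered_field list \<Rightarrow> 'a list \<Rightarrow> bool" where
  "S_le p q \<longleftrightarrow> (\<exists>x a y b. p = [x, a] \<and> q = [y, b] \<and>
     (x = y \<and> a \<le> b \<or> x = 0 \<and> y = 1 \<and> a + 2 \<le> b \<or> x = 1 \<and> y = 0 \<and> a + 1 \<le> b))"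

definition S_poset :: "'a::linordered_field list gorder" where
  "S_poset = \<lparr>carrier = {[x, a] | x a. x \<in> {0, 1} \<and> 0 \<le> a}, eq = (=), le = S_le\<rparr>"

end

theory Submission
  imports Defs
begin

text \<open>
  By o-minimality each of the two columns of a definable downset of \<open>S\<close> is a segment \<open>[0, u)\<close>,
  \<open>[0, u]\<close> or \<open>[0, \<infinity>)\<close>, so a downset is coded by two bounds and their types. Taking integer parts
  maps the Archimedean part of \<open>S\<close> onto the Rieger--Nishimura ladder by a bounded morphism, and
  every element above all integers sees the whole ladder. Hence the downset
  \<open>{1} \<times> [0, 1)\<close> generates the preimages of the finite downsets of the ladder together with \<open>S\<close>.
  Conversely every term in one variable is provably equal to the term naming one of these downsets,
  so the subalgebra is free.
\<close>

subsection \<open>Definable predicates\<close>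

text \<open>The offsets 2 and 1 in the order of S are those of the ladder. If
  \<open>{1} \<times> [k, k + 1)\<close> has number \<open>2 * k\<close> and
  \<open>{0} \<times> [k, k + 1)\<close> has number \<open>2 * k + 1\<close>, then
  \<open>m + 2 \<le> n\<close> between numbers of opposite parity, in blocks starting at
  \<open>k\<close> and \<open>l\<close>, reads \<open>k + 2 \<le> l\<close> for odd \<open>m\<close>
  and \<open>k + 1 \<le> l\<close> for even \<open>m\<close>. In the ladder the principal downset of
  \<open>n\<close> is \<open>{..<n - 1}\<close> with \<open>n\<close> added, and the numbers not
  above \<open>n\<close> are those smaller than \<open>n\<close> together with \<open>n + 1\<close>:
  this is the principal downset of \<open>n + 1\<close>. So every rung is an implication from the
  previous rung to a segment, and \<open>{0}\<close> generates all of them. The field may be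
  non-Archimedean. The union of all blocks is then not definable, so the one infinite downset of the
  ladder has to be interpreted by the whole of S; the finite ones are cut off at integers in both
  columns and are definable. Injectivity has two halves: reduction to normal form bounds the classes
  of terms from above, and evaluation at the integer points of S keeps inequivalent normal forms
  apart.\<close>

definition definable_pred :: "('a::linordered_field, 'f, 'r) expansion \<Rightarrow> ((nat \<Rightarrow> 'a) \<Rightarrow> bool) \<Rightarrow> bool" where
  "definable_pred R P \<longleftrightarrow> (\<exists>p. \<forall>e. sat R e p \<longleftrightarrow> P e)"

definition term_fun :: "('a::linordered_field, 'f, 'r) expansion \<Rightarrow> ((nat \<Rightarrow> 'a) \<Rightarrow> 'a) \<Rightarrow> bool" where
  "term_fun R f \<longleftrightarrow> (\<exists>t. \<forall>e. tm_val R e t = f e)"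

section \<open>Substitution of terms in formulas\<close>

primrec tm_subst :: "(nat \<Rightarrow> ('a, 'f) tm) \<Rightarrow> ('a, 'f) tm \<Rightarrow> ('a, 'f) tm" where
  "tm_subst f (Var i) = f i"
| "tm_subst f (Param a) = Param a"
| "tm_subst f (Plus s t) = Plus (tm_subst f s) (tm_subst f t)"
| "tm_subst f (Times s t) = Times (tm_subst f s) (tm_subst f t)"
| "tm_subst f (App g ts) = App g (map (tm_subst f) ts)"

definition lift_subst :: "(nat \<Rightarrow> ('a, 'f) tm) \<Rightarrow> nat \<Rightarrow> ('a, 'f) tm" where
  "lift_subst f = case_nat (Var 0) (\<lambda>i. tm_subst (\<lambda>j. Var (Suc j)) (f i))"

primrec fm_subst :: "('a, 'f, 'r) fm \<Rightarrow> (nat \<Rightarrow> ('a, 'f) tm) \<Rightarrow> ('a, 'f, 'r) fm" where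
  "fm_subst (Eq s t) f = Eq (tm_subst f s) (tm_subst f t)"
| "fm_subst (Less s t) f = Less (tm_subst f s) (tm_subst f t)"
| "fm_subst (Rel r ts) f = Rel r (map (tm_subst f) ts)"
| "fm_subst (Neg p) f = Neg (fm_subst p f)"
| "fm_subst (Conj p q) f = Conj (fm_subst p f) (fm_subst q f)"
| "fm_subst (Ex p) f = Ex (fm_subst p (lift_subst f))"

lemma tm_val_subst: "tm_val R e (tm_subst f t) = tm_val R (\<lambda>i. tm_val R e (f i)) t"
proof (induction t)
  case (App g ts)
  then show ?case by (simp cong: map_cong)
qed simp_all

lemma tm_val_lift_subst:
  "(\<lambda>i. tm_val R (case_nat x e) (lift_subst f i)) = case_nat x (\<lambda>i. tm_val R e (f i))"
  by (auto simp: fun_eq_iff lift_subst_def tm_val_subst split: nat.split)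

lemma sat_subst: "sat R e (fm_subst p f) \<longleftrightarrow> sat R (\<lambda>i. tm_val R e (f i)) p"
  by (induction p arbitrary: e f) (simp_all add: tm_val_subst o_def tm_val_lift_subst)

section \<open>Closure properties of definable predicates\<close>

lemma term_fun_var [simp, intro]: "term_fun R (\<lambda>e. e i)"
  unfolding term_fun_def by (rule exI[of _ "Var i"]) simp

lemma term_fun_const [simp, intro]: "term_fun R (\<lambda>e. c)"
  unfolding term_fun_def by (rule exI[of _ "Param c"]) simp

lemma term_fun_plus [intro]:
  assumes "term_fun R f" "term_fun R g"
  shows "term_fun R (\<lambda>e. f e + g e)"
  using assms unfolding term_fun_def by (metis tm_val.simps(3))

lemma definable_pred_eq:
  assumes "term_fun R f" "term_fun R g"
  shows "definable_pred R (\<lambda>e. f e = g e)"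
  using assms unfolding term_fun_def definable_pred_def by (metis sat.simps(1))

lemma definable_pred_less:
  assumes "term_fun R f" "term_fun R g"
  shows "definable_pred R (\<lambda>e. f e < g e)"
  using assms unfolding term_fun_def definable_pred_def by (metis sat.simps(2))

lemma definable_pred_not:
  assumes "definable_pred R P"
  shows "definable_pred R (\<lambda>e. \<not> P e)"
  using assms unfolding definable_pred_def by (metis sat.simps(4))

lemma definable_pred_conj:
  assumes "definable_pred R P" "definable_pred R Q"
  shows "definable_pred R (\<lambda>e. P e \<and> Q e)"
  using assms unfolding definable_pred_def by (metis sat.simps(5))

text \<open>Putting the bound value at variable 0 and shifting the others by \<open>Suc\<close>
  mirrors \<open>case_nat\<close> in \<open>sat\<close>. Read backwards, the rule opens a HOL
  quantifier, so formulas can be written as HOL predicates and their definability follows by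
  introduction rules.\<close>

lemma definable_pred_ex:
  assumes "definable_pred R (\<lambda>e. P (e 0) (\<lambda>i. e (Suc i)))"
  shows "definable_pred R (\<lambda>e. \<exists>x. P x e)"
proof -
  obtain p where "\<And>e. sat R e p \<longleftrightarrow> P (e 0) (\<lambda>i. e (Suc i))"
    using assms by (auto simp: definable_pred_def)
  then have "sat R e (Ex p) \<longleftrightarrow> (\<exists>x. P x e)" for e
    by simp
  then show ?thesis
    unfolding definable_pred_def by blast
qed

lemma definable_pred_le:
  assumes "term_fun R f" "term_fun R g"
  shows "definable_pred R (\<lambda>e. f e \<le> g e)"
  using definable_pred_not[OF definable_pred_less[OF assms(2,1)]] by (simp add: not_less)

lemma definable_pred_disj:
  assumes "definable_pred R P" "definable_pred R Q"
  shows "definable_pred R (\<lambda>e. P e \<or> Q e)"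
proof -
  have "definable_pred R (\<lambda>e. \<not> (\<not> P e \<and> \<not> Q e))"
    using assms by (intro definable_pred_not definable_pred_conj)
  then show ?thesis by simp
qed

lemma definable_pred_imp:
  assumes "definable_pred R P" "definable_pred R Q"
  shows "definable_pred R (\<lambda>e. P e \<longrightarrow> Q e)"
  unfolding imp_conv_disj using assms by (intro definable_pred_disj definable_pred_not)

lemma definable_pred_all:
  assumes "definable_pred R (\<lambda>e. P (e 0) (\<lambda>i. e (Suc i)))"
  shows "definable_pred R (\<lambda>e. \<forall>x. P x e)"
proof -
  have "definable_pred R (\<lambda>e. \<exists>x. \<not> P x e)"
    by (rule definable_pred_ex) (rule definable_pred_not[OF assms])
  then have "definable_pred R (\<lambda>e. \<not> (\<exists>x. \<not> P x e))"
    by (rule definable_pred_not)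
  then show ?thesis by simp
qed

lemmas definable_pred_intros =
  definable_pred_eq definable_pred_less definable_pred_le definable_pred_not definable_pred_conj
  definable_pred_disj definable_pred_imp definable_pred_ex definable_pred_all
  term_fun_var term_fun_const term_fun_plus

text \<open>Choosing one term per variable turns \<open>f\<close> into a simultaneous substitution.
  This lets a set that is merely known to be definable be tested at computed coordinates.\<close>

lemma definable_pred_subst:
  assumes "definable_pred R P" "\<And>i. term_fun R (\<lambda>e. f e i)"
  shows "definable_pred R (\<lambda>e. P (f e))"
proof -
  obtain p where p: "\<And>e. sat R e p \<longleftrightarrow> P e"
    using assms(1) by (auto simp: definable_pred_def)
  obtain t where t: "\<And>i e. tm_val R e (t i) = f e i"
    using assms(2) unfolding term_fun_def by metis
  have "sat R e (fm_subst p t) \<longleftrightarrow> P (f e)" for e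
    by (simp add: sat_subst p t)
  then show ?thesis
    unfolding definable_pred_def by blast
qed

lemma definableI:
  assumes "definable_pred R P" "\<And>xs. xs \<in> X \<longleftrightarrow> length xs = n \<and> P (assignment xs)"
  shows "definable R n X"
  using assms unfolding definable_pred_def definable_def by (metis (mono_tags, lifting) mem_Collect_eq subsetI subset_antisym)

lemma definable_length: "definable R n X \<Longrightarrow> xs \<in> X \<Longrightarrow> length xs = n"
  by (auto simp: definable_def)

lemma definable_pred_mem:
  assumes "definable R n X" "\<And>e. length (f e) = n" "\<And>i. i < n \<Longrightarrow> term_fun R (\<lambda>e. f e ! i)"
  shows "definable_pred R (\<lambda>e. f e \<in> X)"
proof -
  obtain p where p: "X = {xs. length xs = n \<and> sat R (assignment xs) p}"
    using assms(1) by (auto simp: definable_def)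
  \<comment> \<open>Past position \<open>n\<close> the assignment has the default value 0, a
    constant term.\<close>
  have "term_fun R (\<lambda>e. assignment (f e) i)" for i
    using assms(2,3) by (cases "i < n") (auto simp: assignment_def)
  moreover have "definable_pred R (\<lambda>e. sat R e p)"
    by (auto simp: definable_pred_def)
  ultimately have "definable_pred R (\<lambda>e. sat R (assignment (f e)) p)"
    by (rule definable_pred_subst[rotated])
  then show ?thesis
    by (simp add: p assms(2))
qed

lemma definable_pred_mem_pair:
  assumes "definable R 2 X" "term_fun R f" "term_fun R g"
  shows "definable_pred R (\<lambda>e. [f e, g e] \<in> X)"
  by (rule definable_pred_mem[OF assms(1)])
    (use assms(2,3) in \<open>auto simp: less_2_cases_iff\<close>)

lemma assignment_nth: "length xs = n \<Longrightarrow> map (assignment xs) [0..<n] = xs"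
  by (rule nth_equalityI) (auto simp: assignment_def)

lemma assignment_simps [simp]:
  "assignment (x # xs) 0 = x"
  "assignment (x # xs) (Suc i) = assignment xs i"
  "assignment [] i = 0"
  by (simp_all add: assignment_def)

subsection \<open>Definability of \<open>S\<close>\<close>

lemma carrier_S: "xs \<in> carrier S_poset \<longleftrightarrow> (\<exists>x a. xs = [x, a] \<and> (x = 0 \<or> x = 1) \<and> 0 \<le> a)"
  by (auto simp: S_poset_def)

lemma le_S: "le S_poset = S_le"
  by (simp add: S_poset_def)

lemma S_le_pair: "S_le [x, a] [y, b] \<longleftrightarrow>
   (x = y \<and> a \<le> b \<or> x = 0 \<and> y = 1 \<and> a + 2 \<le> b \<or> x = 1 \<and> y = 0 \<and> a + 1 \<le> b)"
  by (auto simp: S_le_def)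

lemma partial_order_S: "partial_order (S_poset :: 'a::linordered_field list gorder)"
proof -
  have [simp]: "(.=\<^bsub>S_poset\<^esub>) = ((=) :: 'a list \<Rightarrow> _)"
    by (simp add: S_poset_def)
  show ?thesis
  proof unfold_locales
    fix p q r :: "'a list"
    assume "p \<in> carrier S_poset" "q \<in> carrier S_poset" "r \<in> carrier S_poset"
    then obtain x a y b z c where *: "p = [x, a]" "q = [y, b]" "r = [z, c]"
      by (auto simp: carrier_S)
    assume "p \<sqsubseteq>\<^bsub>S_poset\<^esub> q" "q \<sqsubseteq>\<^bsub>S_poset\<^esub> r"
    then show "p \<sqsubseteq>\<^bsub>S_poset\<^esub> r"
      unfolding * le_S S_le_pair by (elim disjE conjE) simp_all
  next
    fix p q :: "'a list"
    assume "p \<in> carrier S_poset" "q \<in> carrier S_poset"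
    then obtain x a y b where *: "p = [x, a]" "q = [y, b]"
      by (auto simp: carrier_S)
    assume "p \<sqsubseteq>\<^bsub>S_poset\<^esub> q" "q \<sqsubseteq>\<^bsub>S_poset\<^esub> p"
    then show "p .=\<^bsub>S_poset\<^esub> q"
      unfolding * le_S S_le_pair by (elim disjE conjE) simp_all
  qed (auto simp: carrier_S le_S S_le_pair)
qed

lemma length_2_iff: "length xs = 2 \<longleftrightarrow> (\<exists>x y. xs = [x, y])"
  by (auto simp: length_Suc_conv numeral_2_eq_2)

lemma length_4_iff: "length xs = 4 \<longleftrightarrow> (\<exists>x y z w. xs = [x, y, z, w])"
  by (auto simp: length_Suc_conv eval_nat_numeral)

lemma definable_carrier_S: "definable R 2 (carrier S_poset)"
proof (rule definableI)
  show "definable_pred R (\<lambda>e. (e 0 = 0 \<or> e 0 = 1) \<and> 0 \<le> e (Suc 0))"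
    by (intro definable_pred_intros)
qed (auto simp: carrier_S length_2_iff)

text \<open>Fixed lengths make the splitting of a concatenation unique, so the existential over
  pairs of points becomes a condition on \<open>take\<close> and \<open>drop\<close>.\<close>

lemma mem_append_image:
  assumes "\<And>x y. P x y \<Longrightarrow> length x = n \<and> length y = m"
  shows "xs \<in> {x @ y |x y. P x y} \<longleftrightarrow> length xs = n + m \<and> P (take n xs) (drop n xs)"
proof
  assume "xs \<in> {x @ y |x y. P x y}"
  then show "length xs = n + m \<and> P (take n xs) (drop n xs)"
    using assms by fastforce
next
  assume "length xs = n + m \<and> P (take n xs) (drop n xs)"
  then show "xs \<in> {x @ y |x y. P x y}"
    by (intro CollectI exI[of _ "take n xs"] exI[of _ "drop n xs"]) simp
qed

lemma definable_poset_S: "definable_poset R 2 S_poset"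
  unfolding definable_poset_def
proof (intro conjI partial_order_S definable_carrier_S)
  let ?X = "{x @ y |x y. x \<in> carrier S_poset \<and> y \<in> carrier S_poset \<and> x \<sqsubseteq>\<^bsub>S_poset\<^esub> y}"
  show "definable R (2 + 2) ?X"
  proof (rule definableI)
    show "definable_pred R (\<lambda>e. (e 0 = 0 \<or> e 0 = 1) \<and> 0 \<le> e 1 \<and> (e 2 = 0 \<or> e 2 = 1) \<and> 0 \<le> e 3 \<and>
      (e 0 = e 2 \<and> e 1 \<le> e 3 \<or> e 0 = 0 \<and> e 2 = 1 \<and> e 1 + 2 \<le> e 3 \<or>
       e 0 = 1 \<and> e 2 = 0 \<and> e 1 + 1 \<le> e 3))" (is "definable_pred R ?P")
      by (intro definable_pred_intros)
    fix xs :: "'a list"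
    have "xs \<in> ?X \<longleftrightarrow> length xs = 2 + 2 \<and> take 2 xs \<in> carrier S_poset \<and> drop 2 xs \<in> carrier S_poset \<and>
        S_le (take 2 xs) (drop 2 xs)"
      by (subst mem_append_image[where n = 2 and m = 2]) (auto simp: carrier_S le_S)
    also have "\<dots> \<longleftrightarrow> length xs = 2 + 2 \<and> ?P (assignment xs)"
    proof (cases "length xs = 4")
      case True
      then obtain a b c d where "xs = [a, b, c, d]"
        by (auto simp: length_4_iff)
      then show ?thesis
        by (simp add: carrier_S S_le_pair assignment_def conj_ac)
    qed simp
    finally show "xs \<in> ?X \<longleftrightarrow> length xs = 2 + 2 \<and> ?P (assignment xs)" .
  qed
qed

subsection \<open>Heyting algebras of sets and transport of structure\<close>

lemma heyting_algebraI:
  assumes "partial_order A"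
    and "\<And>x y. x \<in> carrier A \<Longrightarrow> y \<in> carrier A \<Longrightarrow> \<exists>s. least A s (Upper A {x, y})"
    and "\<And>x y. x \<in> carrier A \<Longrightarrow> y \<in> carrier A \<Longrightarrow> \<exists>s. greatest A s (Lower A {x, y})"
    and "\<exists>x. least A x (carrier A)"
    and "\<exists>x. greatest A x (carrier A)"
    and "\<And>x y. x \<in> carrier A \<Longrightarrow> y \<in> carrier A \<Longrightarrow> \<exists>z. greatest A z (relpc_set A x y)"
  shows "heyting_algebra A"
proof -
  interpret partial_order A by (rule assms(1))
  show ?thesis
    by unfold_locales (use assms in simp_all)
qed

context heyting_algebra
begin

lemma meet_greatest: "x \<in> carrier A \<Longrightarrow> y \<in> carrier A \<Longrightarrow> greatest A (x \<sqinter> y) (Lower A {x, y})"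
  unfolding meet_def by (rule inf_of_two_greatest)

lemma join_least: "x \<in> carrier A \<Longrightarrow> y \<in> carrier A \<Longrightarrow> least A (x \<squnion> y) (Upper A {x, y})"
  unfolding join_def by (rule sup_of_two_least)

end

text \<open>An order isomorphism matches greatest and least elements of corresponding sets, and
  these determine every Heyting operation. The codes inherit their structure from the downsets along
  \<open>fiber E\<close> in this way.\<close>

lemma heyting_transport:
  assumes B: "heyting_algebra B" and eq: "(.=\<^bsub>A\<^esub>) = (=)"
    and f: "bij_betw f (carrier A) (carrier B)"
    and le: "\<And>x y. x \<in> carrier A \<Longrightarrow> y \<in> carrier A \<Longrightarrow> x \<sqsubseteq>\<^bsub>A\<^esub> y \<longleftrightarrow> f x \<sqsubseteq>\<^bsub>B\<^esub> f y"
  shows "heyting_algebra A" "f \<in> heyting_hom A B"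
proof -
  interpret B: heyting_algebra B by (rule B)
  have car: "f ` carrier A = carrier B"
    by (rule bij_betw_imp_surj_on[OF f])
  have fc: "f x \<in> carrier B" if "x \<in> carrier A" for x
    using imageI[OF that, of f] by (simp only: car)
  have ex: "\<exists>x\<in>carrier A. f x = y" if "y \<in> carrier B" for y
    using that unfolding car[symmetric] by blast
  have inj: "x = y" if "f x = f y" "x \<in> carrier A" "y \<in> carrier A" for x y
    by (rule inj_onD[OF bij_betw_imp_inj_on[OF f] that])
  have A: "partial_order A"
  proof unfold_locales
    fix x y z
    assume "x \<in> carrier A" "y \<in> carrier A" "z \<in> carrier A" "x \<sqsubseteq>\<^bsub>A\<^esub> y" "y \<sqsubseteq>\<^bsub>A\<^esub> z"
    then show "x \<sqsubseteq>\<^bsub>A\<^esub> z"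
      using B.le_trans[of "f x" "f y" "f z"] by (simp add: le fc)
  next
    fix x y
    assume "x \<in> carrier A" "y \<in> carrier A" "x \<sqsubseteq>\<^bsub>A\<^esub> y" "y \<sqsubseteq>\<^bsub>A\<^esub> x"
    then show "x .=\<^bsub>A\<^esub> y"
      using B.le_antisym[of "f x" "f y"] by (simp add: le fc eq inj)
  qed (simp_all add: eq le fc)
  interpret A: partial_order A by (rule A)
  have greatest_iff: "greatest A x T \<longleftrightarrow> greatest B (f x) (f ` T)"
    if "x \<in> carrier A" "T \<subseteq> carrier A" for x T
  proof -
    have "f x \<in> f ` T \<longleftrightarrow> x \<in> T"
      using inj_on_image_mem_iff[OF bij_betw_imp_inj_on[OF f] that] .
    moreover have "f ` T \<subseteq> carrier B"
      using image_mono[OF that(2), of f] unfolding car .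
    ultimately show ?thesis
      unfolding greatest_def using that le by (auto simp: subset_iff)
  qed
  have least_iff: "least A x T \<longleftrightarrow> least B (f x) (f ` T)"
    if "x \<in> carrier A" "T \<subseteq> carrier A" for x T
  proof -
    have "f x \<in> f ` T \<longleftrightarrow> x \<in> T"
      using inj_on_image_mem_iff[OF bij_betw_imp_inj_on[OF f] that] .
    moreover have "f ` T \<subseteq> carrier B"
      using image_mono[OF that(2), of f] unfolding car .
    ultimately show ?thesis
      unfolding least_def using that le by (auto simp: subset_iff)
  qed
  have image: "f ` {z \<in> carrier A. P (f z)} = {z \<in> carrier B. P z}" for P
    unfolding car[symmetric] by blast
  have lower: "f ` Lower A {x, y} = Lower B {f x, f y}" if "x \<in> carrier A" "y \<in> carrier A" for x y
  proof -
    have "Lower A {x, y} = {z \<in> carrier A. f z \<sqsubseteq>\<^bsub>B\<^esub> f x \<and> f z \<sqsubseteq>\<^bsub>B\<^esub> f y}"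
      using that le unfolding Lower_def by blast
    moreover have "Lower B {f x, f y} = {z \<in> carrier B. z \<sqsubseteq>\<^bsub>B\<^esub> f x \<and> z \<sqsubseteq>\<^bsub>B\<^esub> f y}"
      using that fc unfolding Lower_def by blast
    ultimately show ?thesis
      using image[of "\<lambda>z. z \<sqsubseteq>\<^bsub>B\<^esub> f x \<and> z \<sqsubseteq>\<^bsub>B\<^esub> f y"] by simp
  qed
  have upper: "f ` Upper A {x, y} = Upper B {f x, f y}" if "x \<in> carrier A" "y \<in> carrier A" for x y
  proof -
    have "Upper A {x, y} = {z \<in> carrier A. f x \<sqsubseteq>\<^bsub>B\<^esub> f z \<and> f y \<sqsubseteq>\<^bsub>B\<^esub> f z}"
      using that le unfolding Upper_def by blast
    moreover have "Upper B {f x, f y} = {z \<in> carrier B. f x \<sqsubseteq>\<^bsub>B\<^esub> z \<and> f y \<sqsubseteq>\<^bsub>B\<^esub> z}"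
      using that fc unfolding Upper_def by blast
    ultimately show ?thesis
      using image[of "\<lambda>z. f x \<sqsubseteq>\<^bsub>B\<^esub> z \<and> f y \<sqsubseteq>\<^bsub>B\<^esub> z"] by simp
  qed
  have inf: "\<exists>s\<in>carrier A. f s = f x \<sqinter>\<^bsub>B\<^esub> f y \<and> greatest A s (Lower A {x, y})"
    if xy: "x \<in> carrier A" "y \<in> carrier A" for x y
  proof -
    note * = B.meet_greatest[OF xy[THEN fc]]
    obtain s where s: "s \<in> carrier A" "f s = f x \<sqinter>\<^bsub>B\<^esub> f y"
      using ex[OF greatest_closed[OF *]] by blast
    have "greatest A s (Lower A {x, y})"
      by (simp only: greatest_iff[OF s(1) Lower_closed] lower[OF xy] s(2) *)
    then show ?thesis using s by blast
  qed
  have sup: "\<exists>s\<in>carrier A. f s = f x \<squnion>\<^bsub>B\<^esub> f y \<and> least A s (Upper A {x, y})"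
    if xy: "x \<in> carrier A" "y \<in> carrier A" for x y
  proof -
    note * = B.join_least[OF xy[THEN fc]]
    obtain s where s: "s \<in> carrier A" "f s = f x \<squnion>\<^bsub>B\<^esub> f y"
      using ex[OF least_closed[OF *]] by blast
    have "least A s (Upper A {x, y})"
      by (simp only: least_iff[OF s(1) Upper_closed] upper[OF xy] s(2) *)
    then show ?thesis using s by blast
  qed
  have bot: "\<exists>s\<in>carrier A. f s = \<bottom>\<^bsub>B\<^esub> \<and> least A s (carrier A)"
  proof -
    obtain s where s: "s \<in> carrier A" "f s = \<bottom>\<^bsub>B\<^esub>"
      using ex[OF B.bottom_closed] by blast
    have "least A s (carrier A)"
      by (simp only: least_iff[OF s(1) order_refl] car s(2) B.bottom_least)
    then show ?thesis using s by blast
  qed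
  have top: "\<exists>s\<in>carrier A. f s = \<top>\<^bsub>B\<^esub> \<and> greatest A s (carrier A)"
  proof -
    obtain s where s: "s \<in> carrier A" "f s = \<top>\<^bsub>B\<^esub>"
      using ex[OF B.top_closed] by blast
    have "greatest A s (carrier A)"
      by (simp only: greatest_iff[OF s(1) order_refl] car s(2) B.top_greatest)
    then show ?thesis using s by blast
  qed
  \<comment> \<open>So far \<open>A\<close> is only a partial order: its meet is the
    \<open>SOME\<close> of the definition and is identified by uniqueness of greatest elements. It
    precedes implication because \<open>relpc_set\<close> is phrased with the meet.\<close>
  have meet: "f (x \<sqinter>\<^bsub>A\<^esub> y) = f x \<sqinter>\<^bsub>B\<^esub> f y \<and> x \<sqinter>\<^bsub>A\<^esub> y \<in> carrier A"
    if xy: "x \<in> carrier A" "y \<in> carrier A" for x y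
  proof -
    obtain s where s: "s \<in> carrier A" "f s = f x \<sqinter>\<^bsub>B\<^esub> f y" "greatest A s (Lower A {x, y})"
      using inf[OF xy] by blast
    have "greatest A (x \<sqinter>\<^bsub>A\<^esub> y) (Lower A {x, y})"
      unfolding meet_def inf_def by (rule someI[of "\<lambda>s. greatest A s _", OF s(3)])
    then have "x \<sqinter>\<^bsub>A\<^esub> y = s"
      by (rule partial_order.greatest_unique[OF A _ s(3)])
    then show ?thesis
      using s by simp
  qed
  have relpc: "f ` relpc_set A x y = relpc_set B (f x) (f y)"
    if xy: "x \<in> carrier A" "y \<in> carrier A" for x y
  proof -
    have "z \<sqinter>\<^bsub>A\<^esub> x \<sqsubseteq>\<^bsub>A\<^esub> y \<longleftrightarrow> f z \<sqinter>\<^bsub>B\<^esub> f x \<sqsubseteq>\<^bsub>B\<^esub> f y" if "z \<in> carrier A" for z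
      using le[of "z \<sqinter>\<^bsub>A\<^esub> x" y] meet[OF that xy(1)] xy by simp
    then have "relpc_set A x y = {z \<in> carrier A. f z \<sqinter>\<^bsub>B\<^esub> f x \<sqsubseteq>\<^bsub>B\<^esub> f y}"
      unfolding relpc_set_def by blast
    then show ?thesis
      using image[of "\<lambda>z. z \<sqinter>\<^bsub>B\<^esub> f x \<sqsubseteq>\<^bsub>B\<^esub> f y"] by (simp add: relpc_set_def)
  qed
  have imp: "\<exists>s\<in>carrier A. f s = himp B (f x) (f y) \<and> greatest A s (relpc_set A x y)"
    if xy: "x \<in> carrier A" "y \<in> carrier A" for x y
  proof -
    note * = B.himp_greatest[OF xy[THEN fc]]
    obtain s where s: "s \<in> carrier A" "f s = himp B (f x) (f y)"
      using ex[OF greatest_closed[OF *]] by blast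
    have "relpc_set A x y \<subseteq> carrier A"
      by (auto simp: relpc_set_def)
    from greatest_iff[OF s(1) this] have "greatest A s (relpc_set A x y)"
      by (simp only: relpc[OF xy] s(2) *)
    then show ?thesis using s by blast
  qed
  show hA: "heyting_algebra A"
  proof (rule heyting_algebraI[OF A])
    show "\<exists>x. least A x (carrier A)" "\<exists>x. greatest A x (carrier A)"
      using bot top by blast+
    fix x y assume xy: "x \<in> carrier A" "y \<in> carrier A"
    show "\<exists>s. least A s (Upper A {x, y})" "\<exists>s. greatest A s (Lower A {x, y})"
      "\<exists>z. greatest A z (relpc_set A x y)"
      using inf[OF xy] sup[OF xy] imp[OF xy] by blast+
  qed
  then interpret A: heyting_algebra A .
  show "f \<in> heyting_hom A B"
    unfolding heyting_hom_def
  proof (intro CollectI conjI ballI)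
    show "f \<bottom>\<^bsub>A\<^esub> = \<bottom>\<^bsub>B\<^esub>"
      using bot partial_order.least_unique[OF A A.bottom_least] by metis
    show "f \<top>\<^bsub>A\<^esub> = \<top>\<^bsub>B\<^esub>"
      using top partial_order.greatest_unique[OF A A.top_greatest] by metis
    fix x y assume xy: "x \<in> carrier A" "y \<in> carrier A"
    show "f (x \<sqinter>\<^bsub>A\<^esub> y) = f x \<sqinter>\<^bsub>B\<^esub> f y"
      using meet xy by blast
    show "f (x \<squnion>\<^bsub>A\<^esub> y) = f x \<squnion>\<^bsub>B\<^esub> f y"
      using sup[OF xy] partial_order.least_unique[OF A A.join_least[OF xy]] by metis
    show "f (himp A x y) = himp B (f x) (f y)"
      using imp[OF xy] partial_order.greatest_unique[OF A A.himp_greatest[OF xy]] by metis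
  qed (rule fc)
qed

text \<open>Residuation makes \<open>I X Y\<close> the greatest member of \<open>C\<close> whose
  intersection with \<open>X\<close> lies in \<open>Y\<close>, so the choice in \<open>himp\<close>
  can only be \<open>I X Y\<close>.\<close>

lemma heyting_algebra_of_sets:
  fixes C :: "'a set set" and I :: "'a set \<Rightarrow> 'a set \<Rightarrow> 'a set"
  defines "A \<equiv> \<lparr>carrier = C, eq = (=), le = (\<subseteq>)\<rparr>"
  assumes C: "{} \<in> C" "U \<in> C" "\<And>X. X \<in> C \<Longrightarrow> X \<subseteq> U"
    "\<And>X Y. X \<in> C \<Longrightarrow> Y \<in> C \<Longrightarrow> X \<inter> Y \<in> C" "\<And>X Y. X \<in> C \<Longrightarrow> Y \<in> C \<Longrightarrow> X \<union> Y \<in> C"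
    and I: "\<And>X Y. X \<in> C \<Longrightarrow> Y \<in> C \<Longrightarrow> I X Y \<in> C"
    "\<And>X Y Z. X \<in> C \<Longrightarrow> Y \<in> C \<Longrightarrow> Z \<in> C \<Longrightarrow> Z \<subseteq> I X Y \<longleftrightarrow> Z \<inter> X \<subseteq> Y"
  shows "heyting_algebra A" "\<bottom>\<^bsub>A\<^esub> = {}" "\<top>\<^bsub>A\<^esub> = U"
    "\<And>X Y. X \<in> C \<Longrightarrow> Y \<in> C \<Longrightarrow> X \<sqinter>\<^bsub>A\<^esub> Y = X \<inter> Y"
    "\<And>X Y. X \<in> C \<Longrightarrow> Y \<in> C \<Longrightarrow> X \<squnion>\<^bsub>A\<^esub> Y = X \<union> Y"
    "\<And>X Y. X \<in> C \<Longrightarrow> Y \<in> C \<Longrightarrow> himp A X Y = I X Y"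
proof -
  have [simp]: "carrier A = C" "le A = (\<subseteq>)" "(.=\<^bsub>A\<^esub>) = (=)"
    by (simp_all add: A_def)
  have A: "partial_order A"
    by unfold_locales auto
  have meet: "greatest A (X \<inter> Y) (Lower A {X, Y})" if "X \<in> C" "Y \<in> C" for X Y
    using that C unfolding greatest_def Lower_def by auto
  have join: "least A (X \<union> Y) (Upper A {X, Y})" if "X \<in> C" "Y \<in> C" for X Y
    using that C unfolding least_def Upper_def by auto
  have bot: "least A {} (carrier A)" and top: "greatest A U (carrier A)"
    using C by (auto simp: least_def greatest_def)
  show m: "X \<sqinter>\<^bsub>A\<^esub> Y = X \<inter> Y" if "X \<in> C" "Y \<in> C" for X Y
    unfolding meet_def inf_def
    by (rule partial_order.greatest_unique[OF A _ meet[OF that]]) (rule someI, rule meet[OF that])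
  have imp: "greatest A (I X Y) (relpc_set A X Y)" if "X \<in> C" "Y \<in> C" for X Y
  proof -
    have "I X Y \<sqinter>\<^bsub>A\<^esub> X = I X Y \<inter> X" "I X Y \<inter> X \<subseteq> Y"
      using m[OF I(1)[OF that] that(1)] I(2)[OF that I(1)[OF that]] by simp_all
    then show ?thesis
      unfolding greatest_def relpc_set_def using that I m by auto
  qed
  show hA: "heyting_algebra A"
    using meet join bot top imp by (intro heyting_algebraI A) (simp_all, blast+)
  then interpret A: heyting_algebra A .
  show "\<bottom>\<^bsub>A\<^esub> = {}"
    by (rule partial_order.least_unique[OF A A.bottom_least bot])
  show "\<top>\<^bsub>A\<^esub> = U"
    by (rule partial_order.greatest_unique[OF A A.top_greatest top])
  show "X \<squnion>\<^bsub>A\<^esub> Y = X \<union> Y" if "X \<in> C" "Y \<in> C" for X Y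
    using partial_order.least_unique[OF A A.join_least join] that by simp
  show "himp A X Y = I X Y" if "X \<in> C" "Y \<in> C" for X Y
    using partial_order.greatest_unique[OF A A.himp_greatest imp] that by simp
qed

subsection \<open>The Rieger--Nishimura normal form\<close>

lemma hle_meet_iff: "hle u (HMeet s t) \<longleftrightarrow> hle u s \<and> hle u t"
  by (meson hle_meet1 hle_meet2 hle_meetI hle_trans)

lemma hle_join_iff: "hle (HJoin s t) u \<longleftrightarrow> hle s u \<and> hle t u"
  by (meson hle_join1 hle_join2 hle_joinI hle_trans)

lemma hle_imp_iff: "hle u (HImp s t) \<longleftrightarrow> hle (HMeet u s) t"
  by (meson hle_impE hle_impI)

lemma hle_meet_comm: "hle (HMeet s t) (HMeet t s)"
  by (simp add: hle_meet_iff hle_meet1 hle_meet2)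

lemma hle_meet_mono: "hle s s' \<Longrightarrow> hle t t' \<Longrightarrow> hle (HMeet s t) (HMeet s' t')"
  by (meson hle_meet1 hle_meet2 hle_meetI hle_trans)

text \<open>Meeting with \<open>u\<close> has the right adjoint \<open>HImp u\<close> and therefore
  preserves joins: distributivity comes from residuation.\<close>

lemma hle_meet_join_iff: "hle (HMeet u (HJoin s t)) v \<longleftrightarrow> hle (HMeet u s) v \<and> hle (HMeet u t) v"
proof -
  have *: "hle (HMeet u x) v \<longleftrightarrow> hle x (HImp u v)" for x
    by (meson hle_imp_iff hle_meet_comm hle_trans)
  show ?thesis
    by (simp only: * hle_join_iff)
qed

abbreviation heq :: "'v hterm \<Rightarrow> 'v hterm \<Rightarrow> bool" (infix \<open>\<approx>\<close> 50) where
  "s \<approx> t \<equiv> hle s t \<and> hle t s"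

lemma heq_trans: "s \<approx> t \<Longrightarrow> t \<approx> u \<Longrightarrow> s \<approx> u"
  by (meson hle_trans)

lemma heq_meet: "s \<approx> s' \<Longrightarrow> t \<approx> t' \<Longrightarrow> HMeet s t \<approx> HMeet s' t'"
  by (meson hle_meet_mono)

lemma heq_join: "s \<approx> s' \<Longrightarrow> t \<approx> t' \<Longrightarrow> HJoin s t \<approx> HJoin s' t'"
  by (meson hle_join1 hle_join2 hle_joinI hle_trans)

lemma hle_imp_mono: "hle s' s \<Longrightarrow> hle t t' \<Longrightarrow> hle (HImp s t) (HImp s' t')"
  by (meson hle_imp_iff hle_meet_mono hle_refl hle_trans)

lemma heq_imp: "s \<approx> s' \<Longrightarrow> t \<approx> t' \<Longrightarrow> HImp s t \<approx> HImp s' t'"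
  by (meson hle_imp_mono)

text \<open>An implication from \<open>s\<close> sees its conclusion only through the meet with
  \<open>s\<close>. Conclusions incomparable to a rung can thus be exchanged for segments.\<close>

lemma heq_imp_meet: "HMeet s t \<approx> HMeet s t' \<Longrightarrow> HImp s t \<approx> HImp s t'"
  by (meson hle_imp_iff hle_meet1 hle_meet2 hle_meetI hle_refl hle_trans)

text \<open>
  Order the natural numbers by \<open>m \<preceq> n \<longleftrightarrow> m = n \<or> m + 2 \<le> n\<close>. The term \<open>rn_prin n\<close> stands for the
  principal downset of \<open>n\<close> and \<open>rn_seg n\<close> for \<open>{..<n}\<close>; these exhaust the downsets apart from
  the whole set.
\<close>

fun rn_prin :: "nat \<Rightarrow> unit hterm" and rn_seg :: "nat \<Rightarrow> unit hterm" where
  "rn_prin 0 = HVar ()"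
| "rn_prin (Suc n) = HImp (rn_prin n) (rn_seg (n - 1))"
| "rn_seg 0 = HBot"
| "rn_seg (Suc n) = HJoin (rn_seg n) (rn_prin n)"

section \<open>The ladder order among the terms\<close>

lemma rn_seg_mono: "k \<le> l \<Longrightarrow> hle (rn_seg k) (rn_seg l)"
  by (induction l rule: dec_induct) (auto intro: hle_refl hle_trans hle_join1)

lemma rn_prin_le_seg: "n < k \<Longrightarrow> hle (rn_prin n) (rn_seg k)"
  using rn_seg_mono[of "Suc n" k] by (auto intro: hle_trans hle_join2)

lemma rn_prin_meet_Suc: "hle (HMeet (rn_prin n) (rn_prin (Suc n))) (rn_seg (n - 1))"
  by (metis hle_imp_iff hle_meet_comm hle_refl hle_trans rn_prin.simps(2))

text \<open>For \<open>n = j + 2\<close>, residuation asks that \<open>rn_prin (j + 1)\<close> meet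
  \<open>rn_seg (j + 1)\<close> inside \<open>rn_seg j\<close>. Only the last rung
  \<open>rn_prin j\<close> of that segment matters, and consecutive rungs meet in
  \<open>rn_seg (j - 1)\<close>.\<close>

lemma rn_seg_pred_le_prin: "hle (rn_seg (n - 1)) (rn_prin n)"
proof (cases n)
  case (Suc k)
  show ?thesis
  proof (cases k)
    case (Suc j)
    have "hle (HMeet (rn_prin (Suc j)) (rn_seg (Suc j))) (rn_seg j)"
      unfolding rn_seg.simps hle_meet_join_iff
      using hle_meet2 hle_trans[OF hle_trans[OF hle_meet_comm rn_prin_meet_Suc] rn_seg_mono[of "j - 1" j]]
      by auto
    then have "hle (HMeet (rn_seg (Suc j)) (rn_prin (Suc j))) (rn_seg j)"
      by (rule hle_trans[OF hle_meet_comm])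
    then show ?thesis
      by (simp add: \<open>n = Suc k\<close> Suc hle_imp_iff del: rn_seg.simps)
  qed (simp add: Suc hle_bot)
qed (simp add: hle_bot)

lemma rn_seg_le_prin: "k < n \<Longrightarrow> hle (rn_seg k) (rn_prin n)"
  by (rule hle_trans[OF rn_seg_mono rn_seg_pred_le_prin]) simp

lemma rn_prin_mono: "m + 2 \<le> n \<Longrightarrow> hle (rn_prin m) (rn_prin n)"
  by (rule hle_trans[OF rn_prin_le_seg rn_seg_le_prin[of "n - 1"]]) simp_all

text \<open>In the ladder \<open>n - 1\<close> is the only element of \<open>{..<n}\<close> that is
  not below \<open>n\<close>, so it drops out of the meet. For \<open>n = 0\<close> truncated
  subtraction makes the bound \<open>HBot\<close>.\<close>

lemma rn_prin_meet_seg: "hle (HMeet (rn_prin n) (rn_seg n)) (rn_seg (n - 1))"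
proof (cases n)
  case (Suc k)
  have "hle (HMeet (rn_prin (Suc k)) (rn_prin k)) (rn_seg k)"
    by (rule hle_trans[OF hle_trans[OF hle_meet_comm rn_prin_meet_Suc] rn_seg_mono]) simp
  then show ?thesis
    by (simp add: Suc hle_meet_join_iff hle_meet2 del: rn_prin.simps)
qed (simp add: hle_meet2)

section \<open>Normal forms and their meets\<close>

definition rn_normal :: "unit hterm \<Rightarrow> bool" where
  "rn_normal t \<longleftrightarrow> t \<approx> HTop \<or> (\<exists>n. t \<approx> rn_prin n) \<or> (\<exists>k. t \<approx> rn_seg k)"

lemma rn_normal_basic: "rn_normal HTop" "rn_normal (rn_prin n)" "rn_normal (rn_seg k)"
  by (auto simp: rn_normal_def intro: hle_refl)

lemma rn_normal_cong: "s \<approx> t \<Longrightarrow> rn_normal t \<Longrightarrow> rn_normal s"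
  unfolding rn_normal_def by (meson hle_trans)

lemma rn_normal_cases:
  assumes "rn_normal t"
  obtains "t \<approx> HTop" | n where "t \<approx> rn_prin n" | k where "t \<approx> rn_seg k"
  using assms unfolding rn_normal_def by blast

lemma heq_meet_absorb: "hle s t \<Longrightarrow> HMeet s t \<approx> s"
  by (simp add: hle_meet1 hle_meet_iff hle_refl)

lemma heq_meet_absorb': "hle s t \<Longrightarrow> HMeet t s \<approx> s"
  by (simp add: hle_meet2 hle_meet_iff hle_refl)

lemma heq_join_absorb: "hle s t \<Longrightarrow> HJoin s t \<approx> t"
  by (simp add: hle_join2 hle_join_iff hle_refl)

lemma heq_join_comm: "HJoin s t \<approx> HJoin t s"
  by (simp add: hle_join1 hle_join2 hle_join_iff)

lemma rn_normal_meet_comm: "rn_normal (HMeet s t) \<Longrightarrow> rn_normal (HMeet t s)"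
  using rn_normal_cong hle_meet_comm by blast

lemma rn_normal_join_comm: "rn_normal (HJoin s t) \<Longrightarrow> rn_normal (HJoin t s)"
  using rn_normal_cong heq_join_comm by blast

lemma rn_normal_meet_le: "hle s t \<or> hle t s \<Longrightarrow> rn_normal s \<Longrightarrow> rn_normal t \<Longrightarrow> rn_normal (HMeet s t)"
  using rn_normal_cong heq_meet_absorb heq_meet_absorb' by blast

lemma rn_normal_join_le: "hle s t \<or> hle t s \<Longrightarrow> rn_normal s \<Longrightarrow> rn_normal t \<Longrightarrow> rn_normal (HJoin s t)"
  using rn_normal_cong heq_join_absorb rn_normal_join_comm by metis

lemma rn_prin_meet_Suc_eq: "HMeet (rn_prin n) (rn_prin (Suc n)) \<approx> rn_seg (n - 1)"
  using rn_prin_meet_Suc rn_seg_pred_le_prin[of n] rn_seg_le_prin[of "n - 1" "Suc n"]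
  by (simp add: hle_meet_iff)

lemma rn_prin_meet_seg_eq: "HMeet (rn_prin n) (rn_seg n) \<approx> rn_seg (n - 1)"
  using rn_prin_meet_seg rn_seg_pred_le_prin[of n] rn_seg_mono[of "n - 1" n]
  by (simp add: hle_meet_iff)

text \<open>Distinct ladder elements are incomparable exactly when they are consecutive; comparable
  ones are settled by absorption.\<close>

lemma nat_dist_cases:
  fixes m n :: nat
  obtains "m = n" | "m = Suc n" | "n = Suc m" | "m + 2 \<le> n" | "n + 2 \<le> m"
  by linarith

lemma rn_normal_meet_prin_prin: "rn_normal (HMeet (rn_prin n) (rn_prin m))"
proof (cases n m rule: nat_dist_cases)
  case 2
  then show ?thesis
    using rn_normal_meet_comm rn_normal_cong rn_prin_meet_Suc_eq rn_normal_basic(3) by metis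
next
  case 3
  then show ?thesis
    using rn_normal_cong rn_prin_meet_Suc_eq rn_normal_basic(3) by metis
qed (auto intro!: rn_normal_meet_le simp: rn_normal_basic hle_refl rn_prin_mono simp del: rn_prin.simps)

lemma rn_normal_meet_prin_seg: "rn_normal (HMeet (rn_prin n) (rn_seg k))"
proof (cases "k = n")
  case True
  then show ?thesis
    using rn_normal_cong rn_prin_meet_seg_eq rn_normal_basic(3) by metis
next
  case False
  then show ?thesis
    by (intro rn_normal_meet_le)
      (auto simp: rn_normal_basic nat_neq_iff rn_seg_le_prin rn_prin_le_seg)
qed

lemma rn_normal_meet_seg_seg: "rn_normal (HMeet (rn_seg k) (rn_seg l))"
  using rn_normal_meet_le rn_normal_basic(3) rn_seg_mono by (metis nle_le)

lemma rn_normal_meet: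
  assumes "rn_normal s" "rn_normal t"
  shows "rn_normal (HMeet s t)"
proof -
  have top: "rn_normal (HMeet s t)" if "s \<approx> HTop" "rn_normal t" for s t
    using that rn_normal_cong[OF heq_meet_absorb' that(2)] hle_top hle_trans by blast
  note cong = rn_normal_cong[OF heq_meet]
  from assms(1) show ?thesis
  proof (cases rule: rn_normal_cases)
    case 1
    then show ?thesis using top assms(2) by blast
  next
    case s: (2 n)
    from assms(2) show ?thesis
    proof (cases rule: rn_normal_cases)
      case 1
      then show ?thesis using top assms(1) rn_normal_meet_comm by blast
    qed (rule cong[OF s], assumption, simp add: rn_normal_meet_prin_prin rn_normal_meet_prin_seg)+
  next
    case s: (3 k)
    from assms(2) show ?thesis
    proof (cases rule: rn_normal_cases)
      case 1
      then show ?thesis using top assms(1) rn_normal_meet_comm by blast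
    next
      case (2 n)
      show ?thesis
        by (rule cong[OF s 2]) (rule rn_normal_meet_comm[OF rn_normal_meet_prin_seg])
    qed (rule cong[OF s], assumption, simp add: rn_normal_meet_seg_seg)
  qed
qed

section \<open>Joins of normal forms\<close>

lemma rn_normal_join_prin_seg: "rn_normal (HJoin (rn_prin n) (rn_seg k))"
proof (cases "k = n")
  case True
  then show ?thesis
    using rn_normal_join_comm rn_normal_basic(3)[of "Suc n"] by simp
next
  case False
  then show ?thesis
    by (intro rn_normal_join_le)
      (auto simp: rn_normal_basic nat_neq_iff rn_seg_le_prin rn_prin_le_seg)
qed

text \<open>Every number smaller than \<open>n\<close> already lies in the principal downset of
  \<open>n + 1\<close>, so two consecutive rungs fill up a segment.\<close>

lemma rn_prin_join_Suc_eq: "HJoin (rn_prin n) (rn_prin (Suc n)) \<approx> rn_seg (Suc (Suc n))"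
proof
  show "hle (HJoin (rn_prin n) (rn_prin (Suc n))) (rn_seg (Suc (Suc n)))"
    by (simp add: hle_join_iff rn_prin_le_seg del: rn_prin.simps rn_seg.simps)
  have "hle (rn_seg n) (rn_prin (Suc n))"
    by (rule rn_seg_le_prin) simp
  then show "hle (rn_seg (Suc (Suc n))) (HJoin (rn_prin n) (rn_prin (Suc n)))"
    by (simp add: hle_join_iff hle_join1 hle_join2 del: rn_prin.simps)
      (meson hle_join2 hle_trans)
qed

lemma rn_normal_join_prin_prin: "rn_normal (HJoin (rn_prin n) (rn_prin m))"
proof (cases n m rule: nat_dist_cases)
  case 2
  then show ?thesis
    using rn_normal_join_comm rn_normal_cong rn_prin_join_Suc_eq rn_normal_basic(3) by metis
next
  case 3
  then show ?thesis
    using rn_normal_cong rn_prin_join_Suc_eq rn_normal_basic(3) by metis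
qed (auto intro!: rn_normal_join_le simp: rn_normal_basic hle_refl rn_prin_mono simp del: rn_prin.simps)

lemma rn_normal_join_seg_seg: "rn_normal (HJoin (rn_seg k) (rn_seg l))"
  using rn_normal_join_le rn_normal_basic(3) rn_seg_mono by (metis nle_le)

lemma rn_normal_join:
  assumes "rn_normal s" "rn_normal t"
  shows "rn_normal (HJoin s t)"
proof -
  have top: "rn_normal (HJoin s t)" if "s \<approx> HTop" for s t
    using that rn_normal_cong[OF _ rn_normal_basic(1)] hle_top hle_join1 hle_trans by blast
  note cong = rn_normal_cong[OF heq_join]
  from assms(1) show ?thesis
  proof (cases rule: rn_normal_cases)
    case 1
    then show ?thesis using top by blast
  next
    case s: (2 n)
    from assms(2) show ?thesis
    proof (cases rule: rn_normal_cases)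
      case 1
      then show ?thesis using top rn_normal_join_comm by blast
    qed (rule cong[OF s], assumption, simp add: rn_normal_join_prin_prin rn_normal_join_prin_seg)+
  next
    case s: (3 k)
    from assms(2) show ?thesis
    proof (cases rule: rn_normal_cases)
      case 1
      then show ?thesis using top rn_normal_join_comm by blast
    next
      case (2 n)
      show ?thesis
        by (rule cong[OF s 2]) (rule rn_normal_join_comm[OF rn_normal_join_prin_seg])
    qed (rule cong[OF s], assumption, simp add: rn_normal_join_seg_seg)
  qed
qed

section \<open>Implications between normal forms\<close>

lemma rn_imp_eq_Suc: "HImp (rn_prin n) (rn_seg (n - 1)) \<approx> rn_prin (Suc n)"
  by (simp add: hle_refl)

text \<open>The principal downset of \<open>n + 2\<close> leaves \<open>{..<n}\<close> only at
  \<open>n\<close> and \<open>n + 2\<close>, and \<open>n\<close> is the lower of the two. Hence the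
  implication excludes exactly what lies above \<open>n\<close>, as in the equation that defines
  \<open>rn_prin (n + 1)\<close>.\<close>

lemma rn_imp_eq_pred: "HImp (rn_prin (n + 2)) (rn_seg n) \<approx> rn_prin (Suc n)"
proof
  show "hle (rn_prin (Suc n)) (HImp (rn_prin (n + 2)) (rn_seg n))"
    using rn_prin_meet_Suc[of "Suc n"] by (simp add: hle_imp_iff del: rn_prin.simps)
  let ?z = "HImp (rn_prin (n + 2)) (rn_seg n)"
  have "hle (HMeet ?z (rn_prin (n + 2))) (rn_seg n)"
    by (simp only: flip: hle_imp_iff) (rule hle_refl)
  then have "hle (HMeet ?z (rn_prin n)) (rn_seg n)"
    by (rule hle_trans[rotated]) (intro hle_meet_mono hle_refl rn_prin_mono, simp)
  then have "hle (HMeet ?z (rn_prin n)) (HMeet (rn_prin n) (rn_seg n))"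
    by (simp add: hle_meet_iff hle_meet2)
  then have "hle (HMeet ?z (rn_prin n)) (rn_seg (n - 1))"
    using rn_prin_meet_seg hle_trans by blast
  then show "hle ?z (rn_prin (Suc n))"
    by (simp add: hle_imp_iff)
qed

text \<open>Both \<open>k\<close> and \<open>k + 1\<close> lie below \<open>n\<close> and outside
  \<open>{..<k}\<close>, and every number from \<open>k\<close> on lies above one of them, so
  nothing outside the segment survives. Formally, \<open>k\<close> puts \<open>?z\<close> below
  \<open>rn_prin (k + 1)\<close>, and then \<open>k + 1\<close> pushes it into
  \<open>rn_seg k\<close>.\<close>

lemma rn_imp_eq_seg:
  assumes "k + 3 \<le> n"
  shows "HImp (rn_prin n) (rn_seg k) \<approx> rn_seg k"
proof
  show "hle (rn_seg k) (HImp (rn_prin n) (rn_seg k))"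
    by (simp add: hle_imp_iff hle_meet1)
  let ?z = "HImp (rn_prin n) (rn_seg k)"
  have z: "hle (HMeet ?z (rn_prin n)) (rn_seg k)"
    by (simp only: flip: hle_imp_iff) (rule hle_refl)
  have "hle (HMeet ?z (rn_prin m)) (rn_seg k)" if "m + 2 \<le> n" for m
    by (rule hle_trans[OF _ z]) (intro hle_meet_mono hle_refl rn_prin_mono that)
  then have 1: "hle (HMeet ?z (rn_prin k)) (rn_seg k)" and 2: "hle (HMeet ?z (rn_prin (Suc k))) (rn_seg k)"
    using assms by (simp_all del: rn_prin.simps)
  have "hle (HMeet ?z (rn_prin k)) (HMeet (rn_prin k) (rn_seg k))"
    using 1 by (simp add: hle_meet_iff hle_meet2)
  then have "hle (HMeet ?z (rn_prin k)) (rn_seg (k - 1))"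
    using rn_prin_meet_seg hle_trans by blast
  then have "hle ?z (rn_prin (Suc k))"
    by (simp add: hle_imp_iff)
  then have "hle ?z (HMeet ?z (rn_prin (Suc k)))"
    by (simp add: hle_meet_iff hle_refl)
  then show "hle ?z (rn_seg k)"
    using 2 hle_trans by blast
qed

text \<open>The element \<open>m\<close> lies below \<open>n\<close> but not below
  \<open>m + 1\<close>, so the implication keeps only what is not above \<open>m\<close>, which is
  the principal downset of \<open>m + 1\<close> again. The successor index makes the conclusion an
  implication, unlike the variable \<open>rn_prin 0\<close>.\<close>

lemma rn_imp_eq_prin:
  assumes "m + 3 \<le> n"
  shows "HImp (rn_prin n) (rn_prin (Suc m)) \<approx> rn_prin (Suc m)"
proof
  show "hle (rn_prin (Suc m)) (HImp (rn_prin n) (rn_prin (Suc m)))"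
    by (subst hle_imp_iff) (rule hle_meet1)
  let ?z = "HImp (rn_prin n) (rn_prin (Suc m))"
  have z: "hle (HMeet ?z (rn_prin n)) (rn_prin (Suc m))"
    by (simp only: flip: hle_imp_iff) (rule hle_refl)
  have "hle (HMeet ?z (rn_prin m)) (HMeet ?z (rn_prin n))"
    using assms by (intro hle_meet_mono hle_refl rn_prin_mono) simp
  then have "hle (HMeet ?z (rn_prin m)) (rn_prin (Suc m))"
    using z hle_trans by blast
  then have "hle (HMeet ?z (rn_prin m)) (HMeet (rn_prin m) (rn_prin (Suc m)))"
    by (simp add: hle_meet_iff hle_meet2 del: rn_prin.simps)
  then have "hle (HMeet ?z (rn_prin m)) (rn_seg (m - 1))"
    using rn_prin_meet_Suc hle_trans by blast
  then show "hle ?z (rn_prin (Suc m))"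
    by (subst rn_prin.simps(2)) (simp only: hle_imp_iff)
qed

lemma rn_normal_imp_le: "hle s t \<Longrightarrow> rn_normal (HImp s t)"
  by (rule rn_normal_cong[OF _ rn_normal_basic(1)])
    (meson hle_imp_iff hle_meet2 hle_top hle_trans)

lemma rn_normal_imp_prin_seg: "rn_normal (HImp (rn_prin n) (rn_seg k))"
proof -
  consider "n < k" | "k = n" | "k = n - 1" | "n = k + 2" | "k + 3 \<le> n"
    by linarith
  then show ?thesis
  proof cases
    case 1
    then show ?thesis by (intro rn_normal_imp_le rn_prin_le_seg)
  next
    case 2
    have "HMeet (rn_prin n) (rn_seg n) \<approx> HMeet (rn_prin n) (rn_seg (n - 1))"
      using rn_prin_meet_seg_eq[of n] rn_seg_mono[of "n - 1" n] rn_seg_pred_le_prin[of n]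
      by (meson hle_meet1 hle_meet2 hle_meetI hle_trans)
    then show ?thesis
      using rn_normal_cong[OF heq_imp_meet] rn_normal_cong[OF rn_imp_eq_Suc] rn_normal_basic(2) 2 by blast
  next
    case 3
    then show ?thesis using rn_normal_cong[OF rn_imp_eq_Suc] rn_normal_basic(2) by blast
  next
    case 4
    then show ?thesis using rn_normal_cong[OF rn_imp_eq_pred] rn_normal_basic(2) by blast
  next
    case 5
    then show ?thesis using rn_normal_cong[OF rn_imp_eq_seg] rn_normal_basic(3) by blast
  qed
qed

lemma rn_normal_imp_of_meet_eq_seg:
  assumes "HMeet (rn_prin n) t \<approx> rn_seg k"
  shows "rn_normal (HImp (rn_prin n) t)"
proof -
  have "HMeet (rn_prin n) t \<approx> HMeet (rn_prin n) (rn_seg k)"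
    using assms by (meson hle_meet1 hle_meet2 hle_meetI hle_trans)
  then show ?thesis
    using rn_normal_cong[OF heq_imp_meet] rn_normal_imp_prin_seg by blast
qed

lemma rn_normal_imp_prin_prin: "rn_normal (HImp (rn_prin n) (rn_prin m))"
proof (cases n m rule: nat_dist_cases)
  case 1
  then show ?thesis by (simp add: rn_normal_imp_le hle_refl)
next
  case 2
  show ?thesis
    by (rule rn_normal_imp_of_meet_eq_seg[of _ _ "m - 1"])
      (use 2 rn_prin_meet_Suc_eq[of m] hle_meet_comm hle_trans in blast)
next
  case 3
  show ?thesis
    by (rule rn_normal_imp_of_meet_eq_seg[of _ _ "n - 1"]) (use 3 rn_prin_meet_Suc_eq[of n] in blast)
next
  case 4
  then show ?thesis by (simp add: rn_normal_imp_le rn_prin_mono)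
next
  case 5
  show ?thesis
  proof (cases m)
    case 0
    \<comment> \<open>The variable is outside the scope of \<open>rn_imp_eq_prin\<close>, but its
      downset \<open>{0}\<close> is also the segment \<open>{..<1}\<close>.\<close>
    have "HVar () \<approx> rn_seg 1"
      by (simp add: hle_bot hle_join2 hle_join_iff hle_refl)
    then show ?thesis
      using 0 rn_normal_cong[OF heq_imp] rn_normal_imp_prin_seg hle_refl by (metis rn_prin.simps(1))
  next
    case (Suc j)
    then show ?thesis
      using rn_normal_cong[OF rn_imp_eq_prin[of j n]] rn_normal_basic(2) 5 by (simp del: rn_prin.simps)
  qed
qed

lemma rn_normal_imp_prin:
  assumes "rn_normal t"
  shows "rn_normal (HImp (rn_prin n) t)"
  using assms
proof (cases rule: rn_normal_cases)
  case 1
  then show ?thesis by (meson hle_top hle_trans rn_normal_imp_le)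
next
  case (2 m)
  then show ?thesis using rn_normal_cong[OF heq_imp] rn_normal_imp_prin_prin hle_refl by blast
next
  case (3 k)
  then show ?thesis using rn_normal_cong[OF heq_imp] rn_normal_imp_prin_seg hle_refl by blast
qed

lemma heq_imp_join: "HImp (HJoin s s') t \<approx> HMeet (HImp s t) (HImp s' t)"
proof
  show "hle (HImp (HJoin s s') t) (HMeet (HImp s t) (HImp s' t))"
    by (simp add: hle_meet_iff hle_imp_mono hle_join1 hle_join2 hle_refl)
  show "hle (HMeet (HImp s t) (HImp s' t)) (HImp (HJoin s s') t)"
    by (simp add: hle_imp_iff hle_meet_join_iff) (meson hle_imp_iff hle_meet1 hle_meet2)
qed

text \<open>A segment is an iterated join of rungs, and implication turns joins on its left into
  meets. Closure under meets and the case of a single rung therefore carry the induction.\<close>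

lemma rn_normal_imp_seg:
  assumes "rn_normal t"
  shows "rn_normal (HImp (rn_seg k) t)"
proof (induction k)
  case 0
  then show ?case by (simp add: rn_normal_imp_le hle_bot)
next
  case (Suc k)
  then show ?case
    using rn_normal_cong[OF heq_imp_join] rn_normal_meet rn_normal_imp_prin[OF assms]
    by (metis rn_seg.simps(2))
qed

lemma rn_normal_imp:
  assumes "rn_normal s" "rn_normal t"
  shows "rn_normal (HImp s t)"
  using assms(1)
proof (cases rule: rn_normal_cases)
  case 1
  have "HImp HTop t \<approx> t"
    by (meson hle_imp_iff hle_meet1 hle_meetI hle_refl hle_top hle_trans)
  then have "HImp s t \<approx> t"
    using 1 heq_imp heq_trans hle_refl by blast
  then show ?thesis using assms(2) rn_normal_cong by blast
next
  case (2 m)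
  then show ?thesis using rn_normal_cong[OF heq_imp] rn_normal_imp_prin assms(2) hle_refl by blast
next
  case (3 k)
  then show ?thesis using rn_normal_cong[OF heq_imp] rn_normal_imp_seg assms(2) hle_refl by blast
qed

theorem rn_normal_all: "rn_normal t"
proof (induction t)
  case (HVar x)
  then show ?case using rn_normal_basic(2)[of 0] by simp
next
  case HBot
  then show ?case using rn_normal_basic(3)[of 0] by simp
qed (simp_all add: rn_normal_basic rn_normal_meet rn_normal_join rn_normal_imp)

subsection \<open>The Heyting algebra of definable downsets\<close>

lemma definable_Int:
  assumes "definable R n X" "definable R n Y"
  shows "definable R n (X \<inter> Y)"
proof -
  obtain p q where "X = {xs. length xs = n \<and> sat R (assignment xs) p}"
    "Y = {xs. length xs = n \<and> sat R (assignment xs) q}"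
    using assms unfolding definable_def by blast
  then have "X \<inter> Y = {xs. length xs = n \<and> sat R (assignment xs) (Conj p q)}"
    by auto
  then show ?thesis unfolding definable_def by blast
qed

lemma definable_Un:
  assumes "definable R n X" "definable R n Y"
  shows "definable R n (X \<union> Y)"
proof -
  obtain p q where "X = {xs. length xs = n \<and> sat R (assignment xs) p}"
    "Y = {xs. length xs = n \<and> sat R (assignment xs) q}"
    using assms unfolding definable_def by blast
  then have "X \<union> Y = {xs. length xs = n \<and> sat R (assignment xs) (Neg (Conj (Neg p) (Neg q)))}"
    by auto
  then show ?thesis unfolding definable_def by blast
qed

lemma definable_empty: "definable R n {}"
proof -
  have "{} = {xs. length xs = n \<and> sat R (assignment xs) (Less (Param 0) (Param 0))}"
    by simp
  then show ?thesis unfolding definable_def by blast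
qed

definition downset_imp :: "'a gorder \<Rightarrow> 'a set \<Rightarrow> 'a set \<Rightarrow> 'a set" where
  "downset_imp P X Y = {p \<in> carrier P. \<forall>q\<in>carrier P. q \<sqsubseteq>\<^bsub>P\<^esub> p \<longrightarrow> q \<in> X \<longrightarrow> q \<in> Y}"

lemma definable_pred_carrier_S:
  assumes "term_fun R f" "term_fun R g"
  shows "definable_pred R (\<lambda>e. [f e, g e] \<in> carrier S_poset)"
  by (rule definable_pred_mem_pair[OF definable_carrier_S assms])

lemma definable_pred_S_le:
  assumes "term_fun R f" "term_fun R g" "term_fun R f'" "term_fun R g'"
  shows "definable_pred R (\<lambda>e. [f e, g e] \<sqsubseteq>\<^bsub>S_poset\<^esub> [f' e, g' e])"
  unfolding le_S S_le_pair by (intro definable_pred_intros assms)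

lemma carrier_S_pairD: "p \<in> carrier S_poset \<Longrightarrow> \<exists>x a. p = [x, a]"
  by (auto simp: carrier_S)

lemma definable_downset_imp:
  assumes "definable R 2 X" "definable R 2 Y"
  shows "definable R 2 (downset_imp S_poset X Y)"
proof (rule definableI)
  show "definable_pred R (\<lambda>e. [e 0, e 1] \<in> carrier S_poset \<and>
      (\<forall>x y. [x, y] \<in> carrier S_poset \<longrightarrow> [x, y] \<sqsubseteq>\<^bsub>S_poset\<^esub> [e 0, e 1] \<longrightarrow> [x, y] \<in> X \<longrightarrow> [x, y] \<in> Y))"
    (is "definable_pred R ?P")
    by (intro definable_pred_intros definable_pred_carrier_S definable_pred_S_le
        definable_pred_mem_pair assms)
  fix xs
  show "xs \<in> downset_imp S_poset X Y \<longleftrightarrow> length xs = 2 \<and> ?P (assignment xs)"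
  proof (cases "length xs = 2")
    case True
    then obtain a b where xs: "xs = [a, b]"
      by (auto simp: length_2_iff)
    have "assignment xs 0 = a" "assignment xs 1 = b"
      by (simp_all add: xs)
    then show ?thesis
      unfolding downset_imp_def using xs carrier_S_pairD by (simp, metis)
  next
    case False
    then show ?thesis
      using definable_length[OF definable_carrier_S] by (auto simp: downset_imp_def)
  qed
qed

lemma down_closed_downset_imp:
  assumes "partial_order P"
  shows "down_closed P (downset_imp P X Y)"
proof -
  interpret partial_order P by (rule assms)
  show ?thesis
    unfolding down_closed_def downset_imp_def using le_trans by blast
qed

lemma subset_downset_imp_iff:
  assumes "partial_order P" "down_closed P Z"
  shows "Z \<subseteq> downset_imp P X Y \<longleftrightarrow> Z \<inter> X \<subseteq> Y"
proof -
  interpret partial_order P by (rule assms)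
  show ?thesis
    using assms(2) le_refl unfolding down_closed_def downset_imp_def by blast
qed

lemma definable_downsets_S:
  fixes R :: "('a::linordered_field, 'f, 'r) expansion"
  defines "D \<equiv> definable_downsets R 2 S_poset"
  shows "heyting_algebra D" "\<bottom>\<^bsub>D\<^esub> = {}" "\<top>\<^bsub>D\<^esub> = carrier S_poset"
    "\<And>X Y. X \<in> carrier D \<Longrightarrow> Y \<in> carrier D \<Longrightarrow> X \<sqinter>\<^bsub>D\<^esub> Y = X \<inter> Y"
    "\<And>X Y. X \<in> carrier D \<Longrightarrow> Y \<in> carrier D \<Longrightarrow> X \<squnion>\<^bsub>D\<^esub> Y = X \<union> Y"
    "\<And>X Y. X \<in> carrier D \<Longrightarrow> Y \<in> carrier D \<Longrightarrow> himp D X Y = downset_imp S_poset X Y"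
proof -
  define C :: "'a list set set" where "C = {X. definable R 2 X \<and> down_closed S_poset X}"
  have D: "D = \<lparr>carrier = C, eq = (=), le = (\<subseteq>)\<rparr>" and car: "carrier D = C"
    by (simp_all add: D_def definable_downsets_def C_def)
  have C: "{} \<in> C" "carrier S_poset \<in> C" "\<And>X. X \<in> C \<Longrightarrow> X \<subseteq> carrier S_poset"
    "\<And>X Y. X \<in> C \<Longrightarrow> Y \<in> C \<Longrightarrow> X \<inter> Y \<in> C" "\<And>X Y. X \<in> C \<Longrightarrow> Y \<in> C \<Longrightarrow> X \<union> Y \<in> C"
    by (auto simp: C_def definable_empty definable_carrier_S definable_Int definable_Un down_closed_def)
  have I: "\<And>X Y. X \<in> C \<Longrightarrow> Y \<in> C \<Longrightarrow> downset_imp S_poset X Y \<in> C"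
    by (auto simp: C_def definable_downset_imp down_closed_downset_imp partial_order_S)
  have I': "\<And>X Y Z. X \<in> C \<Longrightarrow> Y \<in> C \<Longrightarrow> Z \<in> C \<Longrightarrow> Z \<subseteq> downset_imp S_poset X Y \<longleftrightarrow> Z \<inter> X \<subseteq> Y"
    by (auto simp: C_def subset_downset_imp_iff partial_order_S)
  note rules = heyting_algebra_of_sets[of C "carrier S_poset" "downset_imp S_poset"]
  show "heyting_algebra D" "\<bottom>\<^bsub>D\<^esub> = {}" "\<top>\<^bsub>D\<^esub> = carrier S_poset"
    unfolding D by (rule rules; fact C I I')+
  fix X Y assume "X \<in> carrier D" "Y \<in> carrier D"
  then have XY: "X \<in> C" "Y \<in> C"
    by (simp_all add: car)
  show "X \<sqinter>\<^bsub>D\<^esub> Y = X \<inter> Y" "X \<squnion>\<^bsub>D\<^esub> Y = X \<union> Y" "himp D X Y = downset_imp S_poset X Y"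
    unfolding D by (rule rules; fact C I I' XY)+
qed

subsection \<open>Covariant regular representations\<close>

lemma append_mem_graph_iff:
  assumes "definable R n (carrier P)" "E \<subseteq> carrier P \<times> L" "length y = n"
  shows "y @ c \<in> {y @ x |y x. (y, x) \<in> E} \<longleftrightarrow> y \<in> fiber E c"
proof -
  have "length y' = n" if "(y', x) \<in> E" for y' x
    using assms(2) that definable_length[OF assms(1)] by blast
  then have "(y @ c = y' @ x) = (y = y' \<and> c = x)" if "(y', x) \<in> E" for y' x
    using that assms(3) by simp
  then show ?thesis
    unfolding fiber_def by blast
qed

lemma definable_pred_fiber_mem:
  assumes P: "definable R n (carrier P)" and E: "E \<subseteq> carrier P \<times> L"
    and E': "definable R (n + m) {y @ x |y x. (y, x) \<in> E}"
    and f: "\<And>e. length (f e) = n" "\<And>i. i < n \<Longrightarrow> term_fun R (\<lambda>e. f e ! i)"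
    and g: "\<And>e. length (g e) = m" "\<And>i. i < m \<Longrightarrow> term_fun R (\<lambda>e. g e ! i)"
  shows "definable_pred R (\<lambda>e. f e \<in> fiber E (g e))"
proof -
  have "definable_pred R (\<lambda>e. f e @ g e \<in> {y @ x |y x. (y, x) \<in> E})"
  proof (rule definable_pred_mem[OF E'])
    show "term_fun R (\<lambda>e. (f e @ g e) ! i)" if "i < n + m" for i
      using that f g(2)[of "i - n"] g(1) by (cases "i < n") (simp_all add: nth_append)
  qed (simp add: f g)
  then show ?thesis
    by (simp only: append_mem_graph_iff[OF P E f(1)])
qed

lemma definable_fiber:
  assumes P: "definable R n (carrier P)" and E: "E \<subseteq> carrier P \<times> L"
    and E': "definable R (n + m) {y @ x |y x. (y, x) \<in> E}" and c: "length c = m"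
  shows "definable R n (fiber E c)"
proof (rule definableI)
  show "definable_pred R (\<lambda>e. map e [0..<n] \<in> fiber E c)"
    by (rule definable_pred_fiber_mem[OF P E E']) (simp_all add: c)
  have "length y = n" if "y \<in> fiber E c" for y
    using that E definable_length[OF P] by (auto simp: fiber_def)
  then show "y \<in> fiber E c \<longleftrightarrow> length y = n \<and> map (assignment y) [0..<n] \<in> fiber E c" for y
    using assignment_nth by metis
qed

lemma definable_code_order:
  assumes P: "definable R 2 (carrier P)" and L: "definable R m L" and E: "E \<subseteq> carrier P \<times> L"
    and E': "definable R (2 + m) {y @ x |y x. (y, x) \<in> E}"
  shows "definable R (m + m) {x @ y |x y. x \<in> L \<and> y \<in> L \<and> fiber E x \<subseteq> fiber E y}"
proof (rule definableI)
  let ?l = "\<lambda>e. map e [0..<m]" and ?r = "\<lambda>e. map (\<lambda>i. e (m + i)) [0..<m]"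
  show "definable_pred R (\<lambda>e. ?l e \<in> L \<and> ?r e \<in> L \<and>
      (\<forall>a b. [a, b] \<in> fiber E (?l e) \<longrightarrow> [a, b] \<in> fiber E (?r e)))" (is "definable_pred R ?P")
    by (intro definable_pred_intros definable_pred_fiber_mem[OF P E E'] definable_pred_mem[OF L])
      (auto simp: less_2_cases_iff)
  fix xs :: "'a list"
  let ?X = "{x @ y |x y. x \<in> L \<and> y \<in> L \<and> fiber E x \<subseteq> fiber E y}"
  have "xs \<in> ?X \<longleftrightarrow> length xs = m + m \<and> take m xs \<in> L \<and> drop m xs \<in> L \<and>
      fiber E (take m xs) \<subseteq> fiber E (drop m xs)"
    by (rule mem_append_image) (auto dest: definable_length[OF L])
  also have "\<dots> \<longleftrightarrow> length xs = m + m \<and> ?P (assignment xs)"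
  proof (cases "length xs = m + m")
    case True
    then have "?l (assignment xs) = take m xs" "?r (assignment xs) = drop m xs"
      by (auto intro!: nth_equalityI simp: assignment_def)
    moreover have "\<exists>a b. y = [a, b]" if "y \<in> fiber E x" for x y
      using that E definable_length[OF P] by (auto simp: fiber_def length_2_iff)
    then have "fiber E x \<subseteq> fiber E y \<longleftrightarrow> (\<forall>a b. [a, b] \<in> fiber E x \<longrightarrow> [a, b] \<in> fiber E y)" for x y
      by blast
    ultimately show ?thesis by simp
  qed simp
  finally show "xs \<in> ?X \<longleftrightarrow> length xs = m + m \<and> ?P (assignment xs)" .
qed

text \<open>The clause on unique codes speaks only of definable downsets. Applying it to a fiber
  takes definability of the fiber, obtained by freezing the code as parameters in the formula for
  the graph.\<close>

lemma bij_betw_fiber: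
  assumes "covariant_regular_rep R n P m L E"
  shows "bij_betw (fiber E) L (carrier (definable_downsets R n P))"
proof -
  have car: "carrier (definable_downsets R n P) = {X. definable R n X \<and> down_closed P X}"
    by (simp add: definable_downsets_def)
  have P: "definable R n (carrier P)" and L: "definable R m L" and E: "E \<subseteq> carrier P \<times> L"
    and E': "definable R (n + m) {y @ x |y x. (y, x) \<in> E}"
    and down: "\<And>x. x \<in> L \<Longrightarrow> down_closed P (fiber E x)"
    and ex1: "\<And>X. definable R n X \<Longrightarrow> down_closed P X \<Longrightarrow> \<exists>!x. x \<in> L \<and> fiber E x = X"
    using assms unfolding covariant_regular_rep_def definable_poset_def by blast+
  have "definable R n (fiber E c)" if "c \<in> L" for c
    by (rule definable_fiber[OF P E E' definable_length[OF L that]])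
  with down ex1 show ?thesis
    unfolding car by (intro bij_betwI') blast+
qed

lemma code_order_heyting:
  assumes "covariant_regular_rep R 2 S_poset m L E"
  shows "definable_heyting_algebra R m (code_order L E)"
    "fiber E \<in> heyting_hom (code_order L E) (definable_downsets R 2 S_poset)"
proof -
  have L: "definable R m L" and E: "E \<subseteq> carrier S_poset \<times> L"
    and E': "definable R (2 + m) {y @ x |y x. (y, x) \<in> E}"
    using assms unfolding covariant_regular_rep_def by blast+
  have A: "heyting_algebra (code_order L E)"
    "fiber E \<in> heyting_hom (code_order L E) (definable_downsets R 2 S_poset)"
  proof -
    have "x \<sqsubseteq>\<^bsub>code_order L E\<^esub> y \<longleftrightarrow> fiber E x \<sqsubseteq>\<^bsub>definable_downsets R 2 S_poset\<^esub> fiber E y" for x y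
      by (simp add: code_order_def definable_downsets_def)
    moreover have "bij_betw (fiber E) (carrier (code_order L E)) (carrier (definable_downsets R 2 S_poset))"
      "(.=\<^bsub>code_order L E\<^esub>) = (=)"
      using bij_betw_fiber[OF assms] by (simp_all add: code_order_def)
    ultimately show "heyting_algebra (code_order L E)"
      "fiber E \<in> heyting_hom (code_order L E) (definable_downsets R 2 S_poset)"
      using heyting_transport[OF definable_downsets_S(1)[of R]] by blast+
  qed
  then show "fiber E \<in> heyting_hom (code_order L E) (definable_downsets R 2 S_poset)"
    by simp
  interpret heyting_algebra "code_order L E" by (rule A)
  have "partial_order (code_order L E)"
    by unfold_locales
  with A(1) definable_code_order[OF definable_carrier_S L E E'] L
  show "definable_heyting_algebra R m (code_order L E)"
    by (simp add: definable_heyting_algebra_def definable_poset_def code_order_def)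
qed

subsection \<open>Codes for definable downsets of \<open>S\<close>\<close>

text \<open>In an ordered field this says that \<open>u\<close> is the supremum of \<open>X\<close>;
  the second clause forces \<open>X\<close> to be non-empty.\<close>

definition sharp_upper_bound :: "'a::linorder set \<Rightarrow> 'a \<Rightarrow> bool" where
  "sharp_upper_bound X u \<longleftrightarrow> (\<forall>x\<in>X. x \<le> u) \<and> (\<forall>v<u. \<exists>x\<in>X. v < x)"

text \<open>This is the amount of completeness that o-minimality supplies. A real-closed field may
  have bounded sets without supremum, but the property holds for intervals and passes to finite
  unions.\<close>

definition sup_or_unbounded :: "'a::linorder set \<Rightarrow> bool" where
  "sup_or_unbounded X \<longleftrightarrow> X = {} \<or> (\<forall>v. \<exists>x\<in>X. v < x) \<or> (\<exists>u. sharp_upper_bound X u)"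

lemma sharp_upper_bound_Un:
  assumes "sharp_upper_bound X u" "sharp_upper_bound Y v" "u \<le> v"
  shows "sharp_upper_bound (X \<union> Y) v"
  using assms unfolding sharp_upper_bound_def by (auto intro: order_trans)

lemma sup_or_unbounded_Un:
  assumes "sup_or_unbounded X" "sup_or_unbounded Y"
  shows "sup_or_unbounded (X \<union> Y)"
proof (cases "X = {} \<or> Y = {} \<or> (\<forall>v. \<exists>x\<in>X. v < x) \<or> (\<forall>v. \<exists>x\<in>Y. v < x)")
  case True
  then show ?thesis
    using assms unfolding sup_or_unbounded_def by auto
next
  case False
  then obtain u v where "sharp_upper_bound X u" "sharp_upper_bound Y v"
    using assms unfolding sup_or_unbounded_def by blast
  then have "sharp_upper_bound (X \<union> Y) v \<or> sharp_upper_bound (Y \<union> X) u"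
    using sharp_upper_bound_Un[of X u Y v] sharp_upper_bound_Un[of Y v X u] linear[of u v] by blast
  then show ?thesis
    unfolding sup_or_unbounded_def Un_commute[of Y X] by blast
qed

lemma sup_or_unbounded_interval:
  fixes I :: "'a::linordered_field set"
  assumes "point_or_open_interval I"
  shows "sup_or_unbounded I"
proof -
  have unbounded: "sup_or_unbounded I" if "\<And>v. \<exists>x\<in>I. v < x"
    using that by (simp add: sup_or_unbounded_def)
  have bounded: "sup_or_unbounded I" if "sharp_upper_bound I u" for u
    using that by (auto simp: sup_or_unbounded_def)
  consider a where "I = {a}" | a b where "I = {a<..<b}" | b where "I = {..<b}" | a where "I = {a<..}"
    | "I = UNIV"
    using assms unfolding point_or_open_interval_def by blast
  then show ?thesis
  proof cases
    case (1 a)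
    then show ?thesis by (intro bounded[of a]) (simp add: sharp_upper_bound_def)
  next
    case (2 a b)
    show ?thesis
    proof (cases "a < b")
      case True
      have "\<exists>x\<in>I. v < x" if "v < b" for v
        using dense[of "max a v" b] True that by (auto simp: 2)
      then show ?thesis
        by (intro bounded[of b]) (auto simp: sharp_upper_bound_def 2)
    next
      case False
      then show ?thesis by (simp add: 2 sup_or_unbounded_def)
    qed
  next
    case (3 b)
    have "\<exists>x\<in>I. v < x" if "v < b" for v
      using dense[OF that] by (auto simp: 3)
    then show ?thesis
      by (intro bounded[of b]) (auto simp: sharp_upper_bound_def 3)
  next
    case (4 a)
    have "\<exists>x\<in>I. v < x" for v
      using gt_ex[of "max a v"] by (auto simp: 4)
    then show ?thesis by (rule unbounded)
  next
    case 5
    have "\<exists>x\<in>I. v < x" for v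
      using gt_ex[of v] by (simp add: 5)
    then show ?thesis by (rule unbounded)
  qed
qed

lemma sup_or_unbounded_Union:
  fixes F :: "'a::linordered_field set set"
  assumes "finite F" "\<forall>I\<in>F. point_or_open_interval I"
  shows "sup_or_unbounded (\<Union>F)"
  using assms
proof (induction F)
  case empty
  then show ?case by (simp add: sup_or_unbounded_def)
next
  case (insert I F)
  then show ?case by (simp add: sup_or_unbounded_Un sup_or_unbounded_interval)
qed

text \<open>
  The pair \<open>(0, u)\<close> codes \<open>[0, u)\<close>, which is empty for \<open>u = 0\<close>; \<open>(1, u)\<close> codes \<open>[0, u]\<close>; and
  \<open>(2, 0)\<close> codes \<open>[0, \<infinity>)\<close>.
\<close>

definition segment_code :: "'a::linordered_field \<Rightarrow> 'a \<Rightarrow> bool" where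
  "segment_code t u \<longleftrightarrow> 0 \<le> u \<and> (t = 0 \<or> t = 1 \<or> t = 2 \<and> u = 0)"

definition in_segment :: "'a::linordered_field \<Rightarrow> 'a \<Rightarrow> 'a \<Rightarrow> bool" where
  "in_segment t u a \<longleftrightarrow> 0 \<le> a \<and> (t = 0 \<and> a < u \<or> t = 1 \<and> a \<le> u \<or> t = 2)"

lemma segment_code_exists:
  fixes X :: "'a::linordered_field set"
  assumes "sup_or_unbounded X" "\<And>a. a \<in> X \<Longrightarrow> 0 \<le> a"
    and down: "\<And>a b. a \<in> X \<Longrightarrow> 0 \<le> b \<Longrightarrow> b \<le> a \<Longrightarrow> b \<in> X"
  shows "\<exists>t u. segment_code t u \<and> (\<forall>a. in_segment t u a \<longleftrightarrow> a \<in> X)"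
proof -
  consider "X = {}" | "\<forall>v. \<exists>x\<in>X. v < x" | u where "sharp_upper_bound X u" "X \<noteq> {}"
    using assms(1) unfolding sup_or_unbounded_def by blast
  then show ?thesis
  proof cases
    case 1
    then show ?thesis
      by (intro exI[of _ 0]) (auto simp: segment_code_def in_segment_def)
  next
    case 2
    have "a \<in> X" if "0 \<le> a" for a
    proof -
      obtain x where "x \<in> X" "a < x"
        using 2[THEN spec, of a] by blast
      then show ?thesis
        using down[of x a] that by simp
    qed
    then have "in_segment 2 0 a \<longleftrightarrow> a \<in> X" for a
      using assms(2)[of a] unfolding in_segment_def by auto
    then show ?thesis
      by (intro exI[of _ 2] exI[of _ 0]) (simp add: segment_code_def)
  next
    case (3 u)
    then have le: "x \<le> u" if "x \<in> X" for x
      using that by (simp add: sharp_upper_bound_def)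
    have less: "a \<in> X" if a: "0 \<le> a" "a < u" for a
    proof -
      obtain x where "x \<in> X" "a < x"
        using 3(1) a(2) unfolding sharp_upper_bound_def by blast
      then show ?thesis
        using down[of x a] a(1) by simp
    qed
    have "0 \<le> u"
    proof -
      obtain x where "x \<in> X"
        using 3(2) by blast
      then show ?thesis
        using le[of x] assms(2)[of x] by simp
    qed
    \<comment> \<open>Whether the supremum is attained decides between the closed and the half-open
      type.\<close>
    show ?thesis
    proof (cases "u \<in> X")
      case True
      then have "in_segment 1 u a \<longleftrightarrow> a \<in> X" for a
        using le[of a] assms(2)[of a] down[of u a] unfolding in_segment_def by auto
      then show ?thesis
        using \<open>0 \<le> u\<close> by (intro exI[of _ 1] exI[of _ u]) (simp add: segment_code_def)
    next
      case False
      then have "in_segment 0 u a \<longleftrightarrow> a \<in> X" for a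
        using le[of a] assms(2)[of a] less[of a] unfolding in_segment_def by (cases "a = u") auto
      then show ?thesis
        using \<open>0 \<le> u\<close> by (intro exI[of _ 0] exI[of _ u]) (simp add: segment_code_def)
    qed
  qed
qed

text \<open>Different finite bounds are told apart by a point strictly between them, which density
  provides; the types remain to be compared.\<close>

lemma segment_code_unique:
  fixes t u t' u' :: "'a::linordered_field"
  assumes "segment_code t u" "segment_code t' u'" "\<And>a. in_segment t u a \<longleftrightarrow> in_segment t' u' a"
  shows "t = t' \<and> u = u'"
proof -
  have gap: "\<exists>a. in_segment t' u' a \<and> \<not> in_segment t u a"
    if u: "u < u'" and c: "segment_code t u" "segment_code t' u'" "t \<noteq> 2" for t u t' u' :: 'a
  proof -
    obtain a where a: "u < a" "a < u'"
      using dense[OF u] by blast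
    then have "in_segment t' u' a" "\<not> in_segment t u a"
      using c unfolding segment_code_def in_segment_def by auto
    then show ?thesis by blast
  qed
  have "u = u'" if "t \<noteq> 2" "t' \<noteq> 2"
    using gap[OF _ assms(1,2) that(1)] gap[OF _ assms(2,1) that(2)] assms(3)
    by (meson linorder_neqE)
  \<comment> \<open>The point \<open>u + 1\<close> lies beyond the bound \<open>u\<close>, so its
    membership in the first segment detects type 2; likewise \<open>u' + 1\<close> for the
    second.\<close>
  moreover have "t = 2 \<longleftrightarrow> t' = 2"
    using assms(1,2) assms(3)[of "u + 1"] assms(3)[of "u' + 1"]
    unfolding segment_code_def in_segment_def by auto
  \<comment> \<open>The common bound itself belongs to the closed segment and not to the half-open
    one.\<close>
  moreover have "t = t'" if "t \<noteq> 2" "t' \<noteq> 2" "u = u'"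
    using assms(1,2) assms(3)[of u] that unfolding segment_code_def in_segment_def by auto
  ultimately show ?thesis
    using assms(1,2) unfolding segment_code_def by (cases "t = 2") simp_all
qed

text \<open>The last two conditions say that the coded set is closed downwards across the two copies.\<close>

definition S_codes :: "'a::linordered_field list set" where
  "S_codes = {[t, u, t', u'] | t u t' u'. segment_code t u \<and> segment_code t' u' \<and>
     (\<forall>a b. 0 \<le> a \<longrightarrow> in_segment t' u' b \<longrightarrow> a + 2 \<le> b \<longrightarrow> in_segment t u a) \<and>
     (\<forall>a b. 0 \<le> a \<longrightarrow> in_segment t u b \<longrightarrow> a + 1 \<le> b \<longrightarrow> in_segment t' u' a)}"

definition S_graph :: "('a::linordered_field list \<times> 'a list) set" where
  "S_graph = {([x, a], [t, u, t', u']) | x a t u t' u'. [t, u, t', u'] \<in> S_codes \<and>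
     (x = 0 \<and> in_segment t u a \<or> x = 1 \<and> in_segment t' u' a)}"

lemma fiber_S_graph:
  "fiber S_graph [t, u, t', u'] = {[x, a] | x a. [t, u, t', u'] \<in> S_codes \<and>
     (x = 0 \<and> in_segment t u a \<or> x = 1 \<and> in_segment t' u' a)}"
  by (auto simp: fiber_def S_graph_def)

lemma definable_pred_segment_code:
  assumes "term_fun R f" "term_fun R g"
  shows "definable_pred R (\<lambda>e. segment_code (f e) (g e))"
  unfolding segment_code_def by (intro definable_pred_intros assms)

lemma definable_pred_in_segment:
  assumes "term_fun R f" "term_fun R g" "term_fun R h"
  shows "definable_pred R (\<lambda>e. in_segment (f e) (g e) (h e))"
  unfolding in_segment_def by (intro definable_pred_intros assms)

lemma S_codes_iff:
  "[t, u, t', u'] \<in> S_codes \<longleftrightarrow> segment_code t u \<and> segment_code t' u' \<and>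
     (\<forall>a b. 0 \<le> a \<longrightarrow> in_segment t' u' b \<longrightarrow> a + 2 \<le> b \<longrightarrow> in_segment t u a) \<and>
     (\<forall>a b. 0 \<le> a \<longrightarrow> in_segment t u b \<longrightarrow> a + 1 \<le> b \<longrightarrow> in_segment t' u' a)"
  by (simp add: S_codes_def)

lemma definable_S_codes: "definable R 4 S_codes"
proof (rule definableI)
  show "definable_pred R (\<lambda>e. segment_code (e 0) (e 1) \<and> segment_code (e 2) (e 3) \<and>
     (\<forall>a b. 0 \<le> a \<longrightarrow> in_segment (e 2) (e 3) b \<longrightarrow> a + 2 \<le> b \<longrightarrow> in_segment (e 0) (e 1) a) \<and>
     (\<forall>a b. 0 \<le> a \<longrightarrow> in_segment (e 0) (e 1) b \<longrightarrow> a + 1 \<le> b \<longrightarrow> in_segment (e 2) (e 3) a))"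
    (is "definable_pred R ?P")
    by (intro definable_pred_intros definable_pred_segment_code definable_pred_in_segment)
  fix xs :: "'a list"
  show "xs \<in> S_codes \<longleftrightarrow> length xs = 4 \<and> ?P (assignment xs)"
  proof (cases "length xs = 4")
    case True
    then obtain a b c d where xs: "xs = [a, b, c, d]"
      by (auto simp: length_4_iff)
    have "assignment xs 0 = a" "assignment xs 1 = b" "assignment xs 2 = c" "assignment xs 3 = d"
      by (simp_all add: xs assignment_def)
    then show ?thesis
      by (simp only: xs S_codes_iff) simp
  next
    case False
    then show ?thesis by (auto simp: S_codes_def)
  qed
qed

lemma definable_S_graph: "definable R (2 + 4) {y @ x |y x. (y, x) \<in> S_graph}"
proof (rule definableI)
  show "definable_pred R (\<lambda>e. [e 2, e 3, e 4, e 5] \<in> S_codes \<and>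
      (e 0 = 0 \<and> in_segment (e 2) (e 3) (e 1) \<or> e 0 = 1 \<and> in_segment (e 4) (e 5) (e 1)))"
    (is "definable_pred R ?P")
    by (intro definable_pred_intros definable_pred_in_segment definable_pred_mem[OF definable_S_codes])
      (auto simp: less_Suc_eq numeral_eq_Suc)
  fix xs :: "'a list"
  let ?X = "{y @ x |y x. (y, x) \<in> S_graph}"
  have "xs \<in> ?X \<longleftrightarrow> length xs = 2 + 4 \<and> (take 2 xs, drop 2 xs) \<in> S_graph"
    by (rule mem_append_image) (auto simp: S_graph_def)
  also have "\<dots> \<longleftrightarrow> length xs = 2 + 4 \<and> ?P (assignment xs)"
  proof (cases "length xs = 6")
    case True
    then obtain x a t u t' u' where xs: "xs = [x, a, t, u, t', u']"
      by (auto simp: length_Suc_conv eval_nat_numeral)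
    have "assignment xs 0 = x" "assignment xs 1 = a" "assignment xs 2 = t" "assignment xs 3 = u"
      "assignment xs 4 = t'" "assignment xs 5 = u'"
      by (simp_all add: xs assignment_def)
    moreover have "(take 2 xs, drop 2 xs) \<in> S_graph \<longleftrightarrow> [t, u, t', u'] \<in> S_codes \<and>
        (x = 0 \<and> in_segment t u a \<or> x = 1 \<and> in_segment t' u' a)"
      by (simp add: xs S_graph_def)
    ultimately show ?thesis by simp
  qed simp
  finally show "xs \<in> ?X \<longleftrightarrow> length xs = 2 + 4 \<and> ?P (assignment xs)" .
qed

text \<open>The order splits into one closure condition within a column and one for each direction
  of crossing. The crossing conditions have the shape used in \<open>S_codes\<close>; the first
  holds for any pair of segments.\<close>

lemma down_closed_S_iff:
  "down_closed S_poset X \<longleftrightarrow> X \<subseteq> carrier S_poset \<and>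
     (\<forall>x a b. [x, a] \<in> X \<longrightarrow> 0 \<le> b \<longrightarrow> b \<le> a \<longrightarrow> [x, b] \<in> X) \<and>
     (\<forall>a b. [1, b] \<in> X \<longrightarrow> 0 \<le> a \<longrightarrow> a + 2 \<le> b \<longrightarrow> [0, a] \<in> X) \<and>
     (\<forall>a b. [0, b] \<in> X \<longrightarrow> 0 \<le> a \<longrightarrow> a + 1 \<le> b \<longrightarrow> [1, a] \<in> X)" (is "?l \<longleftrightarrow> ?r")
proof
  assume l: ?l
  then have sub: "X \<subseteq> carrier S_poset"
    by (simp add: down_closed_def)
  have down: "[y, b] \<in> X" if "[x, a] \<in> X" "[y, b] \<in> carrier S_poset" "S_le [y, b] [x, a]" for x y a b
    using l that by (auto simp: down_closed_def le_S)
  have "x = 0 \<or> x = 1" if "[x, a] \<in> X" for x a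
    using sub that by (auto simp: carrier_S)
  moreover have "0 \<le> a" if "[x, a] \<in> X" for x a
    using sub that by (auto simp: carrier_S)
  ultimately have car: "[x, a] \<in> X \<Longrightarrow> (x = 0 \<or> x = 1) \<and> 0 \<le> a" for x a
    by blast
  show ?r
  proof (intro conjI allI impI sub)
    show "[x, b] \<in> X" if "[x, a] \<in> X" "0 \<le> b" "b \<le> a" for x a b
      using down[OF that(1), of x b] car[OF that(1)] that by (simp add: carrier_S S_le_pair)
    show "[0, a] \<in> X" if "[1, b] \<in> X" "0 \<le> a" "a + 2 \<le> b" for a b
      using down[OF that(1), of 0 a] that by (simp add: carrier_S S_le_pair)
    show "[1, a] \<in> X" if "[0, b] \<in> X" "0 \<le> a" "a + 1 \<le> b" for a b
      using down[OF that(1), of 1 a] that by (simp add: carrier_S S_le_pair)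
  qed
next
  assume r: ?r
  show ?l
    unfolding down_closed_def
  proof (intro conjI ballI impI)
    show "X \<subseteq> carrier S_poset"
      using r by blast
    fix p q
    assume p: "p \<in> X" and q: "q \<in> carrier S_poset" and le: "q \<sqsubseteq>\<^bsub>S_poset\<^esub> p"
    have "p \<in> carrier S_poset"
      using p r by blast
    then obtain x a y b where *: "p = [x, a]" "q = [y, b]" "0 \<le> b"
      using q by (auto simp: carrier_S)
    show "q \<in> X"
      using p le r *(3) unfolding *(1,2) le_S S_le_pair by blast
  qed
qed

lemma down_closed_fiber_S_graph:
  assumes "c \<in> S_codes"
  shows "down_closed S_poset (fiber S_graph c)"
proof -
  obtain t u t' u' where c: "c = [t, u, t', u']"
    using assms by (auto simp: S_codes_def)
  have mono: "in_segment t u b" if "in_segment t u a" "0 \<le> b" "b \<le> a" for t u a b :: 'a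
    using that unfolding in_segment_def by auto
  have mem: "[x, a] \<in> fiber S_graph c \<longleftrightarrow> x = 0 \<and> in_segment t u a \<or> x = 1 \<and> in_segment t' u' a" for x a
    using assms by (simp add: c fiber_S_graph)
  have "fiber S_graph c \<subseteq> carrier S_poset"
    by (auto simp: c fiber_S_graph carrier_S in_segment_def)
  moreover note assms[unfolded c S_codes_iff, THEN conjunct2, THEN conjunct2]
  moreover have "in_segment t u b \<or> \<not> in_segment t u a" "in_segment t' u' b \<or> \<not> in_segment t' u' a"
    if "0 \<le> b" "b \<le> a" for a b
    using mono[OF _ that] by blast+
  ultimately show ?thesis
    unfolding down_closed_S_iff mem by simp blast
qed

section \<open>Existence and uniqueness of codes\<close>

lemma definable_column:
  assumes "definable R 2 X"
  shows "definable R 1 ((\<lambda>a. [a]) ` {a. [x, a] \<in> X})"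
proof (rule definableI)
  show "definable_pred R (\<lambda>e. [x, e 0] \<in> X)"
    by (intro definable_pred_mem_pair assms term_fun_var term_fun_const)
  show "xs \<in> (\<lambda>a. [a]) ` {a. [x, a] \<in> X} \<longleftrightarrow> length xs = 1 \<and> [x, assignment xs 0] \<in> X" for xs
    by (cases xs) (auto simp: image_iff)
qed

lemma ex1_S_code:
  fixes R :: "('a::linordered_field, 'f, 'r) expansion"
  assumes "o_minimal R" "definable R 2 X" "down_closed S_poset X"
  shows "\<exists>!c. c \<in> S_codes \<and> fiber S_graph c = X"
proof -
  note down = assms(3)[unfolded down_closed_S_iff]
  note X = down[THEN conjunct1] down[THEN conjunct2, THEN conjunct1, rule_format]
    down[THEN conjunct2, THEN conjunct2, THEN conjunct1, rule_format]
    down[THEN conjunct2, THEN conjunct2, THEN conjunct2, rule_format]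
  have "\<exists>t u. segment_code t u \<and> (\<forall>a. in_segment t u a \<longleftrightarrow> [x, a] \<in> X)" for x
  proof -
    obtain F where F: "finite F" "\<forall>I\<in>F. point_or_open_interval I" "{a. [x, a] \<in> X} = \<Union>F"
      using assms(1)[unfolded o_minimal_def, rule_format, OF definable_column[OF assms(2), of x]] by (elim exE conjE) (rule that)
    have "sup_or_unbounded {a. [x, a] \<in> X}"
      unfolding F(3) by (rule sup_or_unbounded_Union[OF F(1,2)])
    then have "\<exists>t u. segment_code t u \<and> (\<forall>a. in_segment t u a \<longleftrightarrow> a \<in> {a. [x, a] \<in> X})"
    proof (rule segment_code_exists)
      show "0 \<le> a" if "a \<in> {a. [x, a] \<in> X}" for a
        using X(1)[THEN subsetD, of "[x, a]"] that by (auto simp: carrier_S)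
      show "b \<in> {a. [x, a] \<in> X}" if "a \<in> {a. [x, a] \<in> X}" "0 \<le> b" "b \<le> a" for a b
        using X(2) that unfolding mem_Collect_eq .
    qed
    then show ?thesis by simp
  qed
  \<comment> \<open>For \<open>x\<close> other than 0 and 1 the column is empty and still has a
    code, so one choice covers all \<open>x\<close>.\<close>
  then obtain t u where tu: "\<And>x. segment_code (t x) (u x)" "\<And>x a. in_segment (t x) (u x) a \<longleftrightarrow> [x, a] \<in> X"
    by metis
  let ?c = "[t 0, u 0, t 1, u 1]"
  have c: "?c \<in> S_codes"
    unfolding S_codes_iff tu(2)
    by (intro conjI tu(1) allI impI) (erule X(3) X(4), assumption+)+
  have mem: "p \<in> X \<Longrightarrow> \<exists>x a. p = [x, a] \<and> (x = 0 \<or> x = 1)" for p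
    using X(1)[THEN subsetD, of p] by (auto simp: carrier_S)
  have "fiber S_graph ?c = X"
  proof (rule Set.set_eqI)
    fix p
    show "p \<in> fiber S_graph ?c \<longleftrightarrow> p \<in> X"
      using c mem[of p] by (auto simp: fiber_S_graph tu(2))
  qed
  moreover have "c = ?c" if c': "c \<in> S_codes" "fiber S_graph c = X" for c
  proof -
    obtain r v r' v' where *: "c = [r, v, r', v']"
      using c'(1) by (auto simp: S_codes_def)
    have **: "[x, a] \<in> X \<longleftrightarrow> x = 0 \<and> in_segment r v a \<or> x = 1 \<and> in_segment r' v' a" for x a
      using c' by (auto simp: * fiber_S_graph)
    have "segment_code r v" "segment_code r' v'"
      using c'(1) by (simp_all add: * S_codes_iff)
    then have "r = t 0 \<and> v = u 0" "r' = t 1 \<and> v' = u 1"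
      by (intro segment_code_unique tu(1); simp add: tu(2) **)+
    then show ?thesis by (simp add: *)
  qed
  ultimately show ?thesis using c by blast
qed

theorem covariant_regular_rep_S:
  assumes "o_minimal R"
  shows "covariant_regular_rep R 2 S_poset 4 S_codes S_graph"
  unfolding covariant_regular_rep_def
proof (intro conjI ballI allI impI definable_poset_S definable_S_codes definable_S_graph
    down_closed_fiber_S_graph)
  show "S_graph \<subseteq> carrier S_poset \<times> S_codes"
    by (auto simp: S_graph_def carrier_S in_segment_def)
  show "\<exists>!x. x \<in> S_codes \<and> fiber S_graph x = X" if "definable R 2 X \<and> down_closed S_poset X" for X
    using ex1_S_code assms that by blast
qed

subsection \<open>The Rieger--Nishimura ladder inside \<open>S\<close>\<close>

text \<open>Half-open cuts at integers give unions of blocks \<open>[k, k + 1)\<close>. The two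
  bounds are independent, so such a set need not be a downset.\<close>

definition S_initial :: "'a::linordered_field \<Rightarrow> 'a \<Rightarrow> 'a list set" where
  "S_initial u v = {[x, a] | x a. 0 \<le> a \<and> (x = 0 \<and> a < u \<or> x = 1 \<and> a < v)}"

lemma S_initial_iff [simp]:
  "[x, a] \<in> S_initial u v \<longleftrightarrow> 0 \<le> a \<and> (x = 0 \<and> a < u \<or> x = 1 \<and> a < v)"
  by (simp add: S_initial_def)

lemma S_initial_eqI:
  assumes "X \<subseteq> carrier S_poset"
    "\<And>a. 0 \<le> a \<Longrightarrow> [0, a] \<in> X \<longleftrightarrow> a < u" "\<And>a. 0 \<le> a \<Longrightarrow> [1, a] \<in> X \<longleftrightarrow> a < v"
  shows "X = S_initial u v"
proof (rule Set.set_eqI)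
  fix p
  show "p \<in> X \<longleftrightarrow> p \<in> S_initial u v"
  proof (cases "p \<in> carrier S_poset")
    case True
    then obtain x a where "p = [x, a]" "x = 0 \<or> x = 1" "0 \<le> a"
      by (auto simp: carrier_S)
    then show ?thesis
      using assms(2)[of a] assms(3)[of a] by auto
  next
    case False
    moreover have "S_initial u v \<subseteq> carrier S_poset"
      by (auto simp: S_initial_def carrier_S)
    ultimately show ?thesis
      using assms(1) by blast
  qed
qed

lemma S_initial_Un: "S_initial u v \<union> S_initial u' v' = S_initial (max u u') (max v v')"
  by (rule S_initial_eqI) (auto simp: S_initial_def carrier_S)

lemma mem_downset_imp_S_iff:
  assumes "x = 0 \<or> x = 1" "0 \<le> a"
  shows "[x, a] \<in> downset_imp S_poset X Y \<longleftrightarrow>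
    (\<forall>y b. (y = 0 \<or> y = 1) \<longrightarrow> 0 \<le> b \<longrightarrow> S_le [y, b] [x, a] \<longrightarrow> [y, b] \<in> X \<longrightarrow> [y, b] \<in> Y)"
  using assms by (auto simp: downset_imp_def carrier_S le_S)

text \<open>The first set exceeds the second by the block \<open>{1} \<times> [k, k + 1)\<close>,
  whose least element is \<open>[1, k]\<close>. A point is in the implication iff it is above no
  point of the block, that is, not above \<open>[1, k]\<close>. The new bounds mark where the up-set
  of \<open>[1, k]\<close> begins in each column.\<close>

lemma downset_imp_S_initial_1:
  fixes k :: "'a::linordered_field"
  assumes "0 \<le> k"
  shows "downset_imp S_poset (S_initial l (k + 1)) (S_initial l k) = S_initial (k + 1) k" (is "?X = _")
proof (rule S_initial_eqI)
  show "?X \<subseteq> carrier S_poset"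
    by (auto simp: downset_imp_def)
  fix a :: 'a assume a: "0 \<le> a"
  note mem = mem_downset_imp_S_iff[OF _ a]
  show "[0, a] \<in> ?X \<longleftrightarrow> a < k + 1"
  proof
    assume "[0, a] \<in> ?X"
    then have "S_le [1, k] [0, a] \<longrightarrow> [1, k] \<in> S_initial l (k + 1) \<longrightarrow> [1, k] \<in> S_initial l k"
      using assms unfolding mem[OF disjI1[OF refl]] by blast
    then show "a < k + 1"
      using assms by (simp add: S_le_pair)
  next
    assume "a < k + 1"
    then show "[0, a] \<in> ?X"
      unfolding mem[OF disjI1[OF refl]] by (auto simp: S_le_pair)
  qed
  show "[1, a] \<in> ?X \<longleftrightarrow> a < k"
  proof
    assume "[1, a] \<in> ?X"
    then have "S_le [1, k] [1, a] \<longrightarrow> [1, k] \<in> S_initial l (k + 1) \<longrightarrow> [1, k] \<in> S_initial l k"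
      using assms unfolding mem[OF disjI2[OF refl]] by blast
    then show "a < k"
      using assms by (simp add: S_le_pair)
  next
    assume "a < k"
    then show "[1, a] \<in> ?X"
      unfolding mem[OF disjI2[OF refl]] by (auto simp: S_le_pair)
  qed
qed

text \<open>Here the block in question has least element \<open>[0, k]\<close>, whose up-set begins
  at \<open>k\<close> in its own column and at \<open>k + 2\<close> in the other.\<close>

lemma downset_imp_S_initial_0:
  fixes k :: "'a::linordered_field"
  assumes "0 \<le> k"
  shows "downset_imp S_poset (S_initial (k + 1) l) (S_initial k l) = S_initial k (k + 2)" (is "?X = _")
proof (rule S_initial_eqI)
  show "?X \<subseteq> carrier S_poset"
    by (auto simp: downset_imp_def)
  fix a :: 'a assume a: "0 \<le> a"
  note mem = mem_downset_imp_S_iff[OF _ a]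
  show "[0, a] \<in> ?X \<longleftrightarrow> a < k"
  proof
    assume "[0, a] \<in> ?X"
    then have "S_le [0, k] [0, a] \<longrightarrow> [0, k] \<in> S_initial (k + 1) l \<longrightarrow> [0, k] \<in> S_initial k l"
      using assms unfolding mem[OF disjI1[OF refl]] by blast
    then show "a < k"
      using assms by (simp add: S_le_pair)
  next
    assume "a < k"
    then show "[0, a] \<in> ?X"
      unfolding mem[OF disjI1[OF refl]] by (auto simp: S_le_pair)
  qed
  show "[1, a] \<in> ?X \<longleftrightarrow> a < k + 2"
  proof
    assume "[1, a] \<in> ?X"
    then have "S_le [0, k] [1, a] \<longrightarrow> [0, k] \<in> S_initial (k + 1) l \<longrightarrow> [0, k] \<in> S_initial k l"
      using assms unfolding mem[OF disjI2[OF refl]] by blast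
    then show "a < k + 2"
      using assms by (simp add: S_le_pair)
  next
    assume "a < k + 2"
    then show "[1, a] \<in> ?X"
      unfolding mem[OF disjI2[OF refl]] by (auto simp: S_le_pair)
  qed
qed

text \<open>
  The ladder element \<open>2 * k\<close> corresponds to the block \<open>{1} \<times> [k, k + 1)\<close> of \<open>S\<close> and \<open>2 * k + 1\<close> to
  \<open>{0} \<times> [k, k + 1)\<close>; a downset of the ladder is interpreted as the union of its blocks.
\<close>

definition S_prin :: "nat \<Rightarrow> 'a::linordered_field list set" where
  "S_prin n = (if even n then S_initial (of_nat (n div 2 - 1)) (of_nat (Suc (n div 2)))
    else S_initial (of_nat (Suc (n div 2))) (of_nat (n div 2)))"

definition S_seg :: "nat \<Rightarrow> 'a::linordered_field list set" where
  "S_seg n = S_initial (of_nat (n div 2)) (of_nat (Suc n div 2))"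

text \<open>The least point of block \<open>n\<close>. These points form a copy of the ladder inside
  S, and a union of blocks is recognised by the points it contains.\<close>

definition S_point :: "nat \<Rightarrow> 'a::linordered_field list" where
  "S_point n = [if even n then 1 else 0, of_nat (n div 2)]"

lemma S_point_in_carrier: "S_point n \<in> carrier S_poset"
  by (simp add: S_point_def carrier_S)

lemma S_point_in_prin: "S_point m \<in> S_prin n \<longleftrightarrow> m = n \<or> m + 2 \<le> n"
  unfolding S_point_def S_prin_def
  by (cases "even m"; cases "even n") (simp_all del: of_nat_Suc, presburger+)

lemma S_point_in_seg: "S_point m \<in> S_seg n \<longleftrightarrow> m < n"
  unfolding S_point_def S_seg_def by (auto simp del: of_nat_Suc elim!: evenE oddE)

lemma S_seg_0: "S_seg 0 = {}"
  by (auto simp: S_seg_def S_initial_def)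

lemma S_seg_Suc: "S_seg (Suc n) = S_seg n \<union> S_prin n"
proof (cases "even n")
  case True
  then obtain k where "n = 2 * k" by (rule evenE)
  then show ?thesis
    by (cases k) (simp_all add: S_seg_def S_prin_def S_initial_Un max_def)
next
  case False
  then obtain k where "n = 2 * k + 1" by (rule oddE)
  then show ?thesis
    by (simp add: S_seg_def S_prin_def S_initial_Un max_def)
qed

text \<open>Block \<open>n\<close> is what \<open>S_prin n\<close> has beyond
  \<open>S_seg (n - 1)\<close>, so this is a single implication between initial sets, in column 1
  for even \<open>n\<close> and in column 0 for odd \<open>n\<close>.\<close>

lemma S_prin_Suc:
  "(S_prin (Suc n) :: 'a::linordered_field list set) = downset_imp S_poset (S_prin n) (S_seg (n - 1))"
proof (cases "even n")
  case True
  then obtain k where n: "n = 2 * k" by (rule evenE)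
  \<comment> \<open>Truncated subtraction keeps both equations true at \<open>k = 0\<close>, where
    the segment is empty.\<close>
  have "(n - 1) div 2 = k - 1" "Suc (n - 1) div 2 = k"
    unfolding n by (cases k; simp)+
  then show ?thesis
    using downset_imp_S_initial_1[of "of_nat k :: 'a" "of_nat (k - 1)"]
    by (simp add: S_seg_def S_prin_def n add.commute)
next
  case False
  then obtain k where n: "n = 2 * k + 1" by (rule oddE)
  then show ?thesis
    using downset_imp_S_initial_0[of "of_nat k :: 'a" "of_nat k"]
    by (simp add: S_seg_def S_prin_def add.commute)
qed

lemma definable_S_prin_0: "definable R 2 (S_prin 0)"
proof (rule definableI)
  show "definable_pred R (\<lambda>e. 0 \<le> e 1 \<and> e 0 = 1 \<and> e 1 < 1)"
    by (intro definable_pred_intros)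
  show "xs \<in> S_prin 0 \<longleftrightarrow> length xs = 2 \<and> 0 \<le> assignment xs 1 \<and> assignment xs 0 = 1 \<and> assignment xs 1 < 1" for xs
    by (auto simp: S_prin_def S_initial_def length_2_iff)
qed

lemma down_closed_S_prin_0: "down_closed S_poset (S_prin 0)"
  by (auto simp: S_prin_def down_closed_S_iff S_initial_def carrier_S)

text \<open>\<open>S_seg_Suc\<close> and \<open>S_prin_Suc\<close> are the recursion equations of
  the terms read in downsets. Keeping \<open>g\<close> abstract separates this from the
  codes.\<close>

lemma rn_value:
  assumes "g (HVar ()) = S_prin 0" "g HBot = {}" "\<And>s t. g (HJoin s t) = g s \<union> g t"
    "\<And>s t. g (HImp s t) = downset_imp S_poset (g s) (g t)"
  shows "g (rn_prin n) = S_prin n" "g (rn_seg n) = S_seg n"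
  by (induction n and n rule: rn_prin_rn_seg.induct) (simp_all add: assms S_seg_0 S_seg_Suc S_prin_Suc)

text \<open>Since every term has a normal form, it is enough to tell normal forms apart by their
  traces on the points \<open>S_point m\<close>. The traces coincide only for
  \<open>rn_prin 0\<close> and \<open>rn_seg 1\<close>, and these two are provably
  equivalent.\<close>

lemma rn_value_inj:
  assumes g: "g (HVar ()) = S_prin 0" "g HBot = {}" "g HTop = carrier S_poset"
    "\<And>s t. g (HJoin s t) = g s \<union> g t" "\<And>s t. g (HImp s t) = downset_imp S_poset (g s) (g t)"
    and cong: "\<And>s t. s \<approx> t \<Longrightarrow> g s = g t" and eq: "g s = g t"
  shows "s \<approx> t"
proof -
  define ladder where "ladder t = {m. S_point m \<in> g t}" for t
  have top: "ladder t = UNIV" if "t \<approx> HTop" for t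
    using cong[OF that] by (simp add: ladder_def g(3) S_point_in_carrier)
  have prin: "ladder t = {m. m = n \<or> m + 2 \<le> n}" if "t \<approx> rn_prin n" for t n
    using cong[OF that] by (simp add: ladder_def rn_value[of g, OF g(1,2,4,5)] S_point_in_prin)
  have seg: "ladder t = {..<n}" if "t \<approx> rn_seg n" for t n
    using cong[OF that] by (auto simp: ladder_def rn_value[of g, OF g(1,2,4,5)] S_point_in_seg)
  have top_prin: False if "UNIV = {m. m = n \<or> m + 2 \<le> n}" for n :: nat
    using that[THEN eqset_imp_iff, of "Suc n"] by simp
  have top_seg: False if "UNIV = {..<n}" for n :: nat
    using that[THEN eqset_imp_iff, of n] by simp
  have prin_prin: "m = n" if "{i. i = m \<or> i + 2 \<le> m} = {i. i = n \<or> i + 2 \<le> n}" for m n :: nat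
    using that[THEN eqset_imp_iff, of n] that[THEN eqset_imp_iff, of m] by auto
  \<comment> \<open>For \<open>n > 0\<close> a segment containing \<open>n\<close> contains
    \<open>n - 1\<close>, which the principal downset omits; so \<open>n = 0\<close>, and testing at
    1 bounds \<open>k\<close>.\<close>
  have prin_seg: "n = 0 \<and> k = 1" if "{i. i = n \<or> i + 2 \<le> n} = {..<k}" for n k :: nat
    using that[THEN eqset_imp_iff, of n] that[THEN eqset_imp_iff, of "Suc n"]
      that[THEN eqset_imp_iff, of "n - 1"] by auto
  have unit: "rn_prin 0 \<approx> rn_seg 1"
    by (simp add: hle_bot hle_join2 hle_join_iff hle_refl)
  have ladder: "ladder s = ladder t"
    by (simp add: ladder_def eq)
  have sym: "a \<approx> b \<Longrightarrow> b \<approx> a" for a b :: "unit hterm"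
    by blast
  from rn_normal_all[of s] show ?thesis
  proof (cases rule: rn_normal_cases)
    case s: 1
    from rn_normal_all[of t] show ?thesis
    proof (cases rule: rn_normal_cases)
      case 1
      then show ?thesis using s heq_trans[of s HTop t] by blast
    next
      case (2 n)
      then show ?thesis using ladder top_prin[of n] unfolding top[OF s] prin[OF 2] by blast
    next
      case (3 n)
      then show ?thesis using ladder top_seg[of n] unfolding top[OF s] seg[OF 3] by blast
    qed
  next
    case s: (2 m)
    from rn_normal_all[of t] show ?thesis
    proof (cases rule: rn_normal_cases)
      case 1
      then show ?thesis using ladder top_prin[of m] unfolding top[OF 1] prin[OF s] by blast
    next
      case (2 n)
      have "m = n"
        using ladder unfolding prin[OF s] prin[OF 2] by (rule prin_prin)
      then show ?thesis using s 2 heq_trans[of s "rn_prin m" t] by blast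
    next
      case (3 n)
      have "m = 0 \<and> n = 1"
        using ladder unfolding prin[OF s] seg[OF 3] by (rule prin_seg)
      then have "s \<approx> rn_prin 0" "t \<approx> rn_seg 1"
        using s 3 by blast+
      then show ?thesis
        using heq_trans[OF heq_trans[OF _ unit]] by blast
    qed
  next
    case s: (3 m)
    from rn_normal_all[of t] show ?thesis
    proof (cases rule: rn_normal_cases)
      case 1
      then show ?thesis using ladder top_seg[of m] unfolding top[OF 1] seg[OF s] by blast
    next
      case (2 n)
      have "n = 0 \<and> m = 1"
        using ladder[symmetric] unfolding seg[OF s] prin[OF 2] by (rule prin_seg)
      then have "s \<approx> rn_seg 1" "t \<approx> rn_prin 0"
        using s 2 by blast+
      then show ?thesis
        using heq_trans[OF heq_trans[OF _ sym[OF unit]]] by blast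
    next
      case (3 n)
      have "m = n"
        using ladder unfolding seg[OF s] seg[OF 3] by simp
      then show ?thesis using s 3 heq_trans[of s "rn_seg m" t] by blast
    qed
  qed
qed

subsection \<open>Images of Heyting homomorphisms\<close>

lemma heyting_subalgebra_image:
  assumes A: "heyting_algebra A" and h: "h \<in> heyting_hom A B"
  shows "heyting_subalgebra (h ` carrier A) B"
proof -
  interpret heyting_algebra A by (rule A)
  have hom: "h x \<in> carrier B" "h (x \<sqinter>\<^bsub>A\<^esub> y) = h x \<sqinter>\<^bsub>B\<^esub> h y" "h (x \<squnion>\<^bsub>A\<^esub> y) = h x \<squnion>\<^bsub>B\<^esub> h y"
    "h (himp A x y) = himp B (h x) (h y)" if "x \<in> carrier A" "y \<in> carrier A" for x y
    using h that by (simp_all add: heyting_hom_def)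
  have bt: "h \<bottom>\<^bsub>A\<^esub> = \<bottom>\<^bsub>B\<^esub>" "h \<top>\<^bsub>A\<^esub> = \<top>\<^bsub>B\<^esub>"
    using h by (simp_all add: heyting_hom_def)
  show ?thesis
    unfolding heyting_subalgebra_def
  proof (intro conjI ballI)
    show "h ` carrier A \<subseteq> carrier B"
      using hom(1) by blast
    show "\<bottom>\<^bsub>B\<^esub> \<in> h ` carrier A" "\<top>\<^bsub>B\<^esub> \<in> h ` carrier A"
      unfolding bt[symmetric] by simp_all
    fix x y assume "x \<in> h ` carrier A" "y \<in> h ` carrier A"
    then obtain x' y' where xy: "x' \<in> carrier A" "y' \<in> carrier A" "x = h x'" "y = h y'"
      by blast
    show "x \<sqinter>\<^bsub>B\<^esub> y \<in> h ` carrier A" "x \<squnion>\<^bsub>B\<^esub> y \<in> h ` carrier A" "himp B x y \<in> h ` carrier A"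
      unfolding xy(3,4) hom(2-4)[OF xy(1,2), symmetric] using xy(1,2) himp_closed by simp_all
  qed
qed

lemma free_heyting_embeds:
  assumes rep: "covariant_regular_rep R 2 S_poset m L E"
  shows "\<exists>K h. heyting_subalgebra K (code_order L E) \<and>
    h \<in> heyting_hom F1 (code_order L E) \<and> bij_betw h (carrier F1) K"
proof -
  let ?A = "code_order L E" and ?D = "definable_downsets R 2 S_poset"
  have A: "heyting_algebra ?A" and fib: "fiber E \<in> heyting_hom ?A ?D"
    using code_order_heyting[OF rep] by (simp_all add: definable_heyting_algebra_def)
  have "S_prin 0 \<in> carrier ?D"
    by (simp add: definable_downsets_def definable_S_prin_0 down_closed_S_prin_0)
  \<comment> \<open>Surjectivity of \<open>fiber E\<close> yields a code for the generating downset
    in any representation.\<close>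
  then obtain c where c: "c \<in> L" "fiber E c = S_prin 0"
    using bij_betw_imp_surj_on[OF bij_betw_fiber[OF rep]] by (metis imageE)
  have "c \<in> carrier ?A"
    using c(1) by (simp add: code_order_def)
  from free_heyting_universal[of ?A "\<lambda>_::unit. c", OF A this]
  obtain h where h: "h \<in> heyting_hom F1 ?A" "h (hclass (HVar ())) = c"
    unfolding F1_def by auto
  have hom: "h (hclass t) \<in> carrier ?A" "h (hclass HBot) = \<bottom>\<^bsub>?A\<^esub>" "h (hclass HTop) = \<top>\<^bsub>?A\<^esub>"
    "h (hclass (HJoin s t)) = h (hclass s) \<squnion>\<^bsub>?A\<^esub> h (hclass t)"
    "h (hclass (HImp s t)) = himp ?A (h (hclass s)) (h (hclass t))" for s t
    using h(1) by (simp_all add: heyting_hom_def F1_def flip: hclass_bot hclass_top hclass_join hclass_himp)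
  \<comment> \<open>Reading codes as downsets makes the operations set-theoretic, so that
    \<open>rn_value_inj\<close> applies; equal codes have equal fibers, which gives injectivity of
    \<open>h\<close>.\<close>
  define g where "g t = fiber E (h (hclass t))" for t
  have car: "fiber E x \<in> carrier ?D" if "x \<in> carrier ?A" for x
    using fib that by (simp add: heyting_hom_def)
  have fib': "fiber E \<bottom>\<^bsub>?A\<^esub> = {}" "fiber E \<top>\<^bsub>?A\<^esub> = carrier S_poset"
    using fib by (simp_all add: heyting_hom_def definable_downsets_S)
  have fib'': "fiber E (x \<squnion>\<^bsub>?A\<^esub> y) = fiber E x \<union> fiber E y"
    "fiber E (himp ?A x y) = downset_imp S_poset (fiber E x) (fiber E y)"
    if "x \<in> carrier ?A" "y \<in> carrier ?A" for x y
    using fib that car by (simp_all add: heyting_hom_def flip: definable_downsets_S(5,6)[of _ R])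
  have g: "g (HVar ()) = S_prin 0" "g HBot = {}" "g HTop = carrier S_poset"
    "g (HJoin s t) = g s \<union> g t" "g (HImp s t) = downset_imp S_poset (g s) (g t)" for s t
    by (simp_all add: g_def h(2) c(2) hom fib' fib'')
  have cong: "g s = g t" if "s \<approx> t" for s t
    using that unfolding g_def hclass_eq_iff[symmetric] by simp
  have "inj_on h (carrier F1)"
  proof (rule inj_onI)
    fix X Y assume "X \<in> carrier F1" "Y \<in> carrier F1" and eq: "h X = h Y"
    then obtain s t where st: "X = hclass s" "Y = hclass t"
      by (auto simp: F1_def carrier_free_heyting)
    then have "g s = g t"
      using eq by (simp add: g_def)
    have "s \<approx> t"
    proof (rule rn_value_inj[of g, OF g])
      show "g s' = g t'" if "s' \<approx> t'" for s' t'
        by (rule cong[OF that])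
    qed (fact \<open>g s = g t\<close>)
    then show "X = Y"
      by (simp add: st hclass_eq_iff)
  qed
  moreover have "heyting_subalgebra (h ` carrier F1) ?A"
    using heyting_subalgebra_image h(1) free_heyting_is_heyting_algebra unfolding F1_def by blast
  ultimately show ?thesis
    using h(1) inj_on_imp_bij_betw by blast
qed

theorem mainTheorem6:
  fixes R :: "('a::real_closed_field, 'f, 'r) expansion"
  assumes "o_minimal R"
  shows "(\<exists>m L E. covariant_regular_rep R 2 S_poset m L E) \<and>
    (\<forall>m L E. covariant_regular_rep R 2 S_poset m L E \<longrightarrow>
      definable_heyting_algebra R m (code_order L E) \<and>
      heyting_algebra (definable_downsets R 2 (S_poset :: 'a list gorder)) \<and>
      fiber E \<in> heyting_hom (code_order L E) (definable_downsets R 2 S_poset) \<and>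
      bij_betw (fiber E) L (carrier (definable_downsets R 2 S_poset)) \<and>
      (\<exists>K h. heyting_subalgebra K (code_order L E) \<and>
         h \<in> heyting_hom F1 (code_order L E) \<and> bij_betw h (carrier F1) K))"
proof (intro conjI allI impI)
  show "\<exists>m L E. covariant_regular_rep R 2 S_poset m L E"
    using covariant_regular_rep_S[OF assms] by blast
qed (rule code_order_heyting definable_downsets_S(1) bij_betw_fiber free_heyting_embeds; assumption?)+

end
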